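(* Let $m\geq n\geq 0$ be integers and let $\lambda\subseteq m\times n$ be a partition (i.e. $n\geq\lambda_1\geq\lambda_2\geq\cdots\geq\lambda_m\geq 0$). Let $w(\lambda)$ be the word in $\{\mathsf{n},\mathsf{e}\}$ corresponding to $\lambda$. Then in $\mathscr{P}_{m,n}$ we have \[ w(\lambda)=\sum_{k=0}^{n}\frac{H_k^{m,n}(\lambda)}{[m]_q[m-1]_q\cdots[m-n+1]_q}\,\mathsf{e}^{k}\mathsf{n}^{m}\mathsf{e}^{n-k}. \]
   Context: Let $q$ be an indeterminate. $\mathscr{P}$ denotes the noncommutative associative unital $\mathbb{C}(q)$-algebra generated by two letters $\mathsf{n},\mathsf{e}$ subject to the relations $(1+q)\,\mathsf{ene}=q\,\mathsf{een}+\mathsf{nee}$ and $(1+q)\,\mathsf{nen}=q\,\mathsf{enn}+\mathsf{nne}$. These relations preserve the number of each letter, so $\mathscr{P}=\bigoplus_{m,n\geq 0}\mathscr{P}_{m,n}$, where $\mathscr{P}_{m,n}$ is spanned by the words with $m$ letters $\mathsf{n}$ and $n$ letters $\mathsf{e}$. A word $w$ with $m$ letters $\mathsf{n}$ and $n$ letters $\mathsf{e}$ is identified with the lattice path from $(0,0)$ to $(n,m)$ obtained by reading $w$ left to right, $\mathsf{n}$ being a unit north step and $\mathsf{e}$ a unit east step. The associated partition $\lambda=\lambda(w)\subseteq m\times n$ is the set of cells of the $m\times n$ box (English notation, rows numbered $1,\dots,m$ from top to bottom) lying to the upper-left of the path; explicitly $\lambda_i$ is the number of letters $\mathsf{e}$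 preceding the $(m+1-i)$-th letter $\mathsf{n}$ of $w$. Conversely $w(\lambda)$ denotes the unique word with $\lambda(w(\lambda))=\lambda$. For $j\geq 0$, $[j]_q=1+q+\cdots+q^{j-1}$. $q$-hit numbers: consider the board with $m$ rows (numbered top to bottom) and $n$ columns (numbered left to right), $m\geq n$, and the Ferrers board of $\lambda$, consisting of cells $(r,c)$ with $c\leq\lambda_r$. A maximal nonattacking rook placement is a placement of $n$ rooks, exactly one in each column and at most one in each row. Let $R(m,n,\lambda,k)$ be the set of such placements having exactly $k$ rooks in cells of $\lambda$. For such a placement $p$, a cell not containing a rook is called unattacked if: (for a cell in $\lambda$) there is no rook above it in its column, no rook to its left in its row, and no rook outside $\lambda$ to its right in its row; (for a cell outside $\lambda$) there is no rook above it in its column and no rook outside $\lambda$ to its left in its row. Let $\mathrm{stat}(p)$ be the number of unattacked cells, and $H_k^{m,n}(\lambda)=\sum_{p\in R(m,n,\lambda,k)}q^{\mathrm{stat}(p)}$.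
   Formalization: In the definition of an unattacked cell, "no rook above it in its column" is replaced by "no rook below it in its column" (for cells in and outside λ); with "above" the identity fails, e.g. for m=2, n=1, λ=(1,0). *)

theory Defs
  imports
    "HOL-Computational_Algebra.Polynomial"
    "HOL-Computational_Algebra.Fraction_Field"
    "HOL-Library.Poly_Mapping"
begin

type_synonym ratfun = "complex poly fract"

definition q :: ratfun where
  "q = Fract [:0, 1:] 1"

definition qint :: "nat \<Rightarrow> ratfun" where
  "qint j = (\<Sum>i<j. q ^ i)"


section \<open>The algebra \<open>\<P>\<close>\<close>

datatype letter = N | E

text \<open>
  Words form a monoid under concatenation. In the additive notation that \<^typ>\<open>'a \<Rightarrow>\<^sub>0 'b\<close>
  requires of its index type, \<^typ>\<open>letter list \<Rightarrow>\<^sub>0 ratfun\<close> is then the free unital algebra on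
  the two letters, with convolution as its product.
\<close>

instantiation list :: (type) monoid_add
begin

definition zero_list :: "'a list" where "0 = []"

definition plus_list :: "'a list \<Rightarrow> 'a list \<Rightarrow> 'a list" where "xs + ys = xs @ ys"

instance by intro_classes (simp_all add: zero_list_def plus_list_def)

end

type_synonym free_alg = "letter list \<Rightarrow>\<^sub>0 ratfun"

abbreviation free_word :: "letter list \<Rightarrow> free_alg" where
  "free_word w \<equiv> Poly_Mapping.single w 1"

abbreviation free_const :: "ratfun \<Rightarrow> free_alg" where
  "free_const c \<equiv> Poly_Mapping.single 0 c"

definition relator_ene :: free_alg where
  "relator_ene =
     free_const (1 + q) * free_word [E, N, E]
     - (free_const q * free_word [E, E, N] + free_word [N, E, E])"

definition relator_nen :: free_alg where
  "relator_nen =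
     free_const (1 + q) * free_word [N, E, N]
     - (free_const q * free_word [E, N, N] + free_word [N, N, E])"

text \<open>The two-sided ideal generated by the two relators.\<close>

inductive_set rel_ideal :: "free_alg set" where
  zero: "0 \<in> rel_ideal"
| ene: "a * relator_ene * b \<in> rel_ideal"
| nen: "a * relator_nen * b \<in> rel_ideal"
| add: "x \<in> rel_ideal \<Longrightarrow> y \<in> rel_ideal \<Longrightarrow> x + y \<in> rel_ideal"

lemma rel_ideal_mult_left: "x \<in> rel_ideal \<Longrightarrow> c * x \<in> rel_ideal"
proof (induction rule: rel_ideal.induct)
  case (ene a b)
  show ?case using rel_ideal.ene[of "c * a" b] by (simp add: mult.assoc)
next
  case (nen a b)
  show ?case using rel_ideal.nen[of "c * a" b] by (simp add: mult.assoc)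
qed (auto simp: distrib_left intro: rel_ideal.zero rel_ideal.add)

lemma rel_ideal_mult_right: "x \<in> rel_ideal \<Longrightarrow> x * c \<in> rel_ideal"
proof (induction rule: rel_ideal.induct)
  case (ene a b)
  show ?case using rel_ideal.ene[of a "b * c"] by (simp add: mult.assoc)
next
  case (nen a b)
  show ?case using rel_ideal.nen[of a "b * c"] by (simp add: mult.assoc)
qed (auto simp: distrib_right intro: rel_ideal.zero rel_ideal.add)

lemma rel_ideal_uminus: "x \<in> rel_ideal \<Longrightarrow> - x \<in> rel_ideal"
  using rel_ideal_mult_left[of x "- 1"] by simp

definition rel_cong :: "free_alg \<Rightarrow> free_alg \<Rightarrow> bool" where
  "rel_cong x y \<longleftrightarrow> x - y \<in> rel_ideal"

lemma rel_cong_add: "rel_cong a b \<Longrightarrow> rel_cong c d \<Longrightarrow> rel_cong (a + c) (b + d)"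
  unfolding rel_cong_def using rel_ideal.add[of "a - b" "c - d"] by (simp add: algebra_simps)

lemma rel_cong_uminus: "rel_cong a b \<Longrightarrow> rel_cong (- a) (- b)"
  unfolding rel_cong_def using rel_ideal_uminus[of "a - b"] by simp

lemma rel_cong_mult: "rel_cong a b \<Longrightarrow> rel_cong c d \<Longrightarrow> rel_cong (a * c) (b * d)"
proof -
  assume "rel_cong a b" "rel_cong c d"
  then have "(a - b) * c + b * (c - d) \<in> rel_ideal"
    unfolding rel_cong_def
    by (intro rel_ideal.add rel_ideal_mult_left rel_ideal_mult_right)
  then show ?thesis unfolding rel_cong_def by (simp add: algebra_simps)
qed

quotient_type path_alg = free_alg / rel_cong
proof (rule equivpI)
  show "reflp rel_cong"
    by (auto simp: reflp_def rel_cong_def rel_ideal.zero)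
  show "symp rel_cong"
    unfolding symp_def rel_cong_def by (auto dest: rel_ideal_uminus)
  show "transp rel_cong"
  proof (rule transpI)
    fix x y z
    assume "rel_cong x y" "rel_cong y z"
    then show "rel_cong x z"
      unfolding rel_cong_def using rel_ideal.add[of "x - y" "y - z"] by simp
  qed
qed

instantiation path_alg :: ring
begin

lift_definition zero_path_alg :: path_alg is 0 .
lift_definition plus_path_alg :: "path_alg \<Rightarrow> path_alg \<Rightarrow> path_alg" is "(+)"
  by (rule rel_cong_add)
lift_definition uminus_path_alg :: "path_alg \<Rightarrow> path_alg" is uminus
  by (rule rel_cong_uminus)
lift_definition minus_path_alg :: "path_alg \<Rightarrow> path_alg \<Rightarrow> path_alg" is "(-)"
  unfolding diff_conv_add_uminus by (intro rel_cong_add rel_cong_uminus)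
lift_definition times_path_alg :: "path_alg \<Rightarrow> path_alg \<Rightarrow> path_alg" is "(*)"
  by (rule rel_cong_mult)

instance
proof
  fix a b c :: path_alg
  show "a + b + c = a + (b + c)"
    by transfer (simp add: rel_cong_def rel_ideal.zero algebra_simps)
  show "a + b = b + a"
    by transfer (simp add: rel_cong_def rel_ideal.zero algebra_simps)
  show "0 + a = a"
    by transfer (simp add: rel_cong_def rel_ideal.zero)
  show "- a + a = 0"
    by transfer (simp add: rel_cong_def rel_ideal.zero)
  show "a - b = a + - b"
    by transfer (simp add: rel_cong_def rel_ideal.zero)
  show "a * b * c = a * (b * c)"
    by transfer (simp add: rel_cong_def rel_ideal.zero mult.assoc)
  show "(a + b) * c = a * c + b * c"
    by transfer (simp add: rel_cong_def rel_ideal.zero distrib_right)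
  show "a * (b + c) = a * b + a * c"
    by transfer (simp add: rel_cong_def rel_ideal.zero distrib_left)
qed

end

instantiation path_alg :: monoid_mult
begin

lift_definition one_path_alg :: path_alg is 1 .

instance
proof
  fix a :: path_alg
  show "1 * a = a" by transfer (simp add: rel_cong_def rel_ideal.zero)
  show "a * 1 = a" by transfer (simp add: rel_cong_def rel_ideal.zero)
qed

end

lift_definition scale_path_alg :: "ratfun \<Rightarrow> path_alg \<Rightarrow> path_alg"  (infixr "*\<^sub>P" 75)
  is "\<lambda>c x. free_const c * x"
  by (rule rel_cong_mult) (simp_all add: rel_cong_def rel_ideal.zero)

global_interpretation path_alg: vector_space scale_path_alg
  defines path_alg_span = path_alg.span
proof
  fix a b :: ratfun and x y :: path_alg
  show "a *\<^sub>P (x + y) = a *\<^sub>P x + a *\<^sub>P y"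
    by transfer (simp add: rel_cong_def rel_ideal.zero distrib_left)
  show "(a + b) *\<^sub>P x = a *\<^sub>P x + b *\<^sub>P x"
    by transfer (simp add: rel_cong_def rel_ideal.zero single_add distrib_right)
  show "a *\<^sub>P b *\<^sub>P x = (a * b) *\<^sub>P x"
    by transfer (simp add: rel_cong_def rel_ideal.zero mult_single flip: mult.assoc)
  show "1 *\<^sub>P x = x"
    by transfer (simp add: rel_cong_def rel_ideal.zero)
qed

lift_definition gen :: "letter \<Rightarrow> path_alg" is "\<lambda>a. free_word [a]" .

abbreviation \<n> :: path_alg where "\<n> \<equiv> gen N"
abbreviation \<e> :: path_alg where "\<e> \<equiv> gen E"

definition word_alg :: "letter list \<Rightarrow> path_alg" where
  "word_alg w = prod_list (map gen w)"

definition path_alg_component :: "nat \<Rightarrow> nat \<Rightarrow> path_alg set" where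
  "path_alg_component m n =
     path_alg_span {word_alg w | w. count_list w N = m \<and> count_list w E = n}"


section \<open>Words and partitions\<close>

text \<open>
  A partition in the \<open>m \<times> n\<close> box is given by its row lengths \<open>lam 1, \<dots>, lam m\<close>; the values of
  \<open>lam\<close> outside \<open>{1..m}\<close> are irrelevant throughout.
\<close>

definition partition_in_box :: "nat \<Rightarrow> nat \<Rightarrow> (nat \<Rightarrow> nat) \<Rightarrow> bool" where
  "partition_in_box m n lam \<longleftrightarrow> (\<forall>i\<in>{1..m}. lam i \<le> n) \<and> antimono_on {1..m} lam"

definition n_positions :: "letter list \<Rightarrow> nat list" where
  "n_positions w = filter (\<lambda>k. w ! k = N) [0..<length w]"

text \<open>List indices start at 0, so the \<open>(m + 1 - i)\<close>-th letter \<open>N\<close> has list index \<open>m - i\<close>.\<close>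

definition partition_of_word :: "letter list \<Rightarrow> nat \<Rightarrow> nat" where
  "partition_of_word w i =
     count_list (take (n_positions w ! (count_list w N - i)) w) E"

definition is_word_of :: "nat \<Rightarrow> nat \<Rightarrow> (nat \<Rightarrow> nat) \<Rightarrow> letter list \<Rightarrow> bool" where
  "is_word_of m n lam w \<longleftrightarrow>
     count_list w N = m \<and> count_list w E = n \<and> (\<forall>i\<in>{1..m}. partition_of_word w i = lam i)"

text \<open>Existence and uniqueness are proved in \<open>ex1_word_of\<close> below.\<close>

definition word_of :: "nat \<Rightarrow> nat \<Rightarrow> (nat \<Rightarrow> nat) \<Rightarrow> letter list" where
  "word_of m n lam = (THE w. is_word_of m n lam w)"

lemma n_positions_Nil [simp]: "n_positions [] = []"
  by (simp add: n_positions_def)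

lemma n_positions_Cons:
  "n_positions (a # w) = (if a = N then [0] else []) @ map Suc (n_positions w)"
proof -
  have "[0..<length (a # w)] = 0 # map Suc [0..<length w]"
    by (simp add: map_Suc_upt upt_conv_Cons del: upt_Suc)
  then show ?thesis by (simp add: n_positions_def filter_map o_def)
qed

lemma length_n_positions [simp]: "length (n_positions w) = count_list w N"
  by (induction w) (auto simp: n_positions_Cons)

lemma partition_of_word_N:
  assumes "1 \<le> i" "i \<le> Suc (count_list w N)"
  shows "partition_of_word (N # w) i =
         (if i = Suc (count_list w N) then 0 else partition_of_word w i)"
  using assms by (auto simp: partition_of_word_def n_positions_Cons nth_Cons Suc_diff_le)

lemma partition_of_word_E:
  assumes "1 \<le> i" "i \<le> count_list w N"
  shows "partition_of_word (E # w) i = Suc (partition_of_word w i)"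
  using assms by (auto simp: partition_of_word_def n_positions_Cons)

lemma is_word_of_N_iff:
  "is_word_of m n lam (N # w) \<longleftrightarrow> (\<exists>m'. m = Suc m' \<and> lam m = 0 \<and> is_word_of m' n lam w)"
proof -
  have *: "(\<forall>i\<in>{1..Suc l}. P i) \<longleftrightarrow> P (Suc l) \<and> (\<forall>i\<in>{1..l}. P i)" for l P
    by (subst atLeastAtMostSuc_conv) auto
  have "(\<forall>i\<in>{1..Suc (count_list w N)}. partition_of_word (N # w) i = lam i) \<longleftrightarrow>
        lam (Suc (count_list w N)) = 0 \<and> (\<forall>i\<in>{1..count_list w N}. partition_of_word w i = lam i)"
    unfolding * by (simp add: partition_of_word_N eq_commute[of 0])
  then show ?thesis by (auto simp: is_word_of_def simp del: atLeastAtMost_iff)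
qed

lemma is_word_of_E_iff:
  "is_word_of m n lam (E # w) \<longleftrightarrow>
     (\<exists>n'. n = Suc n' \<and> (\<forall>i\<in>{1..m}. lam i > 0) \<and> is_word_of m n' (\<lambda>i. lam i - 1) w)"
proof -
  have "Suc a = b \<longleftrightarrow> b > 0 \<and> a = b - 1" for a b :: nat by auto
  then have "(\<forall>i\<in>{1..count_list w N}. partition_of_word (E # w) i = lam i) \<longleftrightarrow>
        (\<forall>i\<in>{1..count_list w N}. lam i > 0) \<and>
        (\<forall>i\<in>{1..count_list w N}. partition_of_word w i = lam i - 1)"
    by (simp add: partition_of_word_E ball_conj_distrib del: One_nat_def)
  then show ?thesis by (auto simp: is_word_of_def simp del: atLeastAtMost_iff)
qed

lemma ex1_word_of:
  assumes "partition_in_box m n lam"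
  shows "\<exists>!w. is_word_of m n lam w"
  using assms
proof (induction "m + n" arbitrary: m n lam)
  case 0
  show ?case
  proof
    show "is_word_of m n lam []" using 0 by (simp add: is_word_of_def)
    fix w assume "is_word_of m n lam w"
    then show "w = []" using 0
      by (cases w rule: list.exhaust; cases "hd w") (auto simp: is_word_of_def)
  qed
next
  case (Suc s)
  have not_Nil: "\<not> is_word_of m n lam []" using Suc.hyps(2) by (auto simp: is_word_of_def)
  show ?case
  proof (cases "m > 0 \<and> lam m = 0")
    case True
    then obtain m' where m: "m = Suc m'" by (cases m) auto
    have "partition_in_box m' n lam"
      using Suc.prems m by (auto simp: partition_in_box_def monotone_on_def)
    then have "\<exists>!w. is_word_of m' n lam w" using Suc.hyps m by auto
    moreover have "is_word_of m n lam w \<longleftrightarrow> (\<exists>w'. w = N # w' \<and> is_word_of m' n lam w')" for w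
    proof (cases w)
      case Nil
      then show ?thesis using not_Nil by simp
    next
      case (Cons a w')
      then show ?thesis using True m
        by (cases a) (auto simp: is_word_of_N_iff is_word_of_E_iff)
    qed
    ultimately show ?thesis by auto
  next
    case False
    have pos: "lam i > 0" if "i \<in> {1..m}" for i
    proof -
      have "lam m \<le> lam i" using Suc.prems that
        by (auto simp: partition_in_box_def monotone_on_def)
      then show ?thesis using False that by auto
    qed
    have "n \<noteq> 0"
    proof
      assume "n = 0"
      then have "m \<ge> 1" using Suc.hyps(2) by simp
      then have "lam m \<le> n" "lam m > 0"
        using Suc.prems pos by (auto simp: partition_in_box_def)
      then show False using \<open>n = 0\<close> by simp
    qed
    then obtain n' where n: "n = Suc n'" by (cases n) auto
    have "partition_in_box m n' (\<lambda>i. lam i - 1)"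
      using Suc.prems n unfolding partition_in_box_def monotone_on_def
      by (force intro: diff_le_mono)
    then have "\<exists>!w. is_word_of m n' (\<lambda>i. lam i - 1) w" using Suc.hyps n by auto
    moreover have "is_word_of m n lam w \<longleftrightarrow>
      (\<exists>w'. w = E # w' \<and> is_word_of m n' (\<lambda>i. lam i - 1) w')" for w
    proof (cases w)
      case Nil
      then show ?thesis using not_Nil by simp
    next
      case (Cons a w')
      then show ?thesis using False n pos
        by (cases a) (auto simp: is_word_of_N_iff is_word_of_E_iff)
    qed
    ultimately show ?thesis by auto
  qed
qed


section \<open>\<open>q\<close>-hit numbers\<close>

text \<open>Cells are pairs (row, column), both numbered from 1, rows from top to bottom.\<close>

definition board :: "nat \<Rightarrow> nat \<Rightarrow> (nat \<times> nat) set" where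
  "board m n = {1..m} \<times> {1..n}"

definition cells :: "nat \<Rightarrow> nat \<Rightarrow> (nat \<Rightarrow> nat) \<Rightarrow> (nat \<times> nat) set" where
  "cells m n lam = {(r, c) \<in> board m n. c \<le> lam r}"

definition rook_placements :: "nat \<Rightarrow> nat \<Rightarrow> (nat \<times> nat) set set" where
  "rook_placements m n =
     {p. p \<subseteq> board m n \<and> (\<forall>c\<in>{1..n}. \<exists>!r. (r, c) \<in> p) \<and>
         (\<forall>r c c'. (r, c) \<in> p \<longrightarrow> (r, c') \<in> p \<longrightarrow> c = c')}"

definition hit_placements :: "nat \<Rightarrow> nat \<Rightarrow> (nat \<Rightarrow> nat) \<Rightarrow> nat \<Rightarrow> (nat \<times> nat) set set" where
  "hit_placements m n lam k = {p \<in> rook_placements m n. card (p \<inter> cells m n lam) = k}"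

text \<open>
  The column condition asks that no rook lie \<^emph>\<open>below\<close> the cell, where the source says
  \<^emph>\<open>above\<close>. This is a deliberate correction: read with \<^emph>\<open>above\<close>, the expansion of \<open>w(\<lambda>)\<close>
  fails for \<open>m > n\<close>. For \<open>m = 2\<close>, \<open>n = 1\<close>, \<open>\<lambda> = (1, 0)\<close> one would get \<open>H\<^sub>0 = q\<close> and \<open>H\<^sub>1 = 1\<close>,
  whereas \<open>(1 + q) nen = q enn + nne\<close> forces \<open>H\<^sub>0 = 1\<close> and \<open>H\<^sub>1 = q\<close>.
\<close>

definition unattacked ::
    "nat \<Rightarrow> nat \<Rightarrow> (nat \<Rightarrow> nat) \<Rightarrow> (nat \<times> nat) set \<Rightarrow> nat \<Rightarrow> nat \<Rightarrow> bool" where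
  "unattacked m n lam p r c \<longleftrightarrow>
     (r, c) \<notin> p \<and>
     (if (r, c) \<in> cells m n lam
      then (\<forall>r'>r. (r', c) \<notin> p) \<and>
           (\<forall>c'<c. (r, c') \<notin> p) \<and>
           (\<forall>c'>c. (r, c') \<notin> p - cells m n lam)
      else (\<forall>r'>r. (r', c) \<notin> p) \<and>
           (\<forall>c'<c. (r, c') \<notin> p - cells m n lam))"

definition stat :: "nat \<Rightarrow> nat \<Rightarrow> (nat \<Rightarrow> nat) \<Rightarrow> (nat \<times> nat) set \<Rightarrow> nat" where
  "stat m n lam p = card {(r, c) \<in> board m n. unattacked m n lam p r c}"

definition hit_number :: "nat \<Rightarrow> nat \<Rightarrow> (nat \<Rightarrow> nat) \<Rightarrow> nat \<Rightarrow> ratfun" where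
  "hit_number m n lam k = (\<Sum>p\<in>hit_placements m n lam k. q ^ stat m n lam p)"

end

theory Submission
  imports Defs
begin

text \<open>
  The words \<open>\<e>\<^sup>k \<n>\<^sup>m \<e>\<^sup>n\<^sup>-\<^sup>k\<close> span the component of bidegree \<open>(m, n)\<close> when \<open>n \<le> m\<close>: the commutator
  \<open>\<c> = \<e>\<n> - \<n>\<e>\<close> satisfies \<open>\<c>\<e> = q \<e>\<c>\<close> and \<open>\<n>\<c> = q \<c>\<n>\<close>, so the monomials \<open>\<e>\<^sup>a \<c>\<^sup>j \<n>\<^sup>b\<close> span, and these
  are reached from the words above through \<open>\<n>\<^sup>m \<e> = \<e> \<n>\<^sup>m - [m] \<c> \<n>\<^sup>m\<^sup>-\<^sup>1\<close>. On the other hand the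
  \<open>q\<close>-hit numbers, as functions of the word, satisfy the two defining relations of the algebra, so
  \<open>w(\<lambda>) \<mapsto> \<Sum>\<^sub>k H\<^sub>k(\<lambda>) \<e>\<^sup>k \<n>\<^sup>m \<e>\<^sup>n\<^sup>-\<^sup>k\<close> is a well-defined linear map. For a rectangle all rooks of the first
  \<open>k\<close> columns are hits and no others, so this map multiplies each spanning word, and hence the whole
  component, by \<open>[m][m-1]\<cdots>[m-n+1]\<close>.
\<close>

section \<open>Transfer recursion for \<open>q\<close>-hit numbers\<close>

context
  fixes Q x :: "'a :: comm_ring_1"
begin

text \<open>The cyclic order runs through \<open>s + 1, s + 2, ...\<close> and then through the
  columns up to \<open>s\<close>. The total number of columns does not enter: comparison with
  \<open>s\<close> already tells on which side of the wrap a column lies.\<close>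

definition cyc_before :: "nat \<Rightarrow> nat \<Rightarrow> nat \<Rightarrow> bool" where
  "cyc_before s c d \<longleftrightarrow> (if s < d then s < c \<and> c < d else s < c \<or> c < d)"

text \<open>In a row of length \<open>s\<close> a rook in column \<open>d\<close> is a hit exactly
  when \<open>d \<le> s\<close>, whence the factor \<open>x\<close>.\<close>

definition rook_weight :: "nat \<Rightarrow> nat set \<Rightarrow> nat \<Rightarrow> 'a" where
  "rook_weight s U d = (if s < d then 1 else x) * Q ^ card {c \<in> U. cyc_before s c d}"

definition place_rook :: "nat \<Rightarrow> (nat set \<Rightarrow> 'a) \<Rightarrow> nat set \<Rightarrow> 'a" where
  "place_rook s f U = (\<Sum>d\<in>U. rook_weight s U d * f (U - {d}))"

text \<open>A row may stay without a rook; every open column then contributes an unattacked cell,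
  whence \<open>Q ^ card U\<close>.\<close>

definition add_row :: "nat \<Rightarrow> (nat set \<Rightarrow> 'a) \<Rightarrow> nat set \<Rightarrow> 'a" where
  "add_row s f U = Q ^ card U * f U + place_rook s f U"

text \<open>
  Rook placements are built row by row from the bottom, that is, along the word from left to
  right: \<open>s\<close> is the number of letters \<open>E\<close> read so far and \<open>U\<close> the set of columns whose rook is
  still to be placed. If the rook of the current row goes to column \<open>d\<close>, the unattacked cells of
  that row lie in the columns of \<open>U\<close> met before \<open>d\<close> in the cyclic order starting at \<open>s + 1\<close>;
  \<open>x\<close> marks the hits.
\<close>

primrec transfer :: "letter list \<Rightarrow> nat \<Rightarrow> nat set \<Rightarrow> 'a" where
  "transfer [] s = (\<lambda>U. if U = {} then 1 else 0)"
| "transfer (l # w) s = (case l of N \<Rightarrow> add_row s (transfer w s) | E \<Rightarrow> transfer w (Suc s))"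

lemma transfer_append_E: "transfer (replicate k E @ w) s = transfer w (s + k)"
  by (induction k arbitrary: s) auto

lemma place_rook_cong:
  "(\<And>d. d \<in> U \<Longrightarrow> f (U - {d}) = g (U - {d})) \<Longrightarrow> place_rook s f U = place_rook s g U"
  unfolding place_rook_def by (rule sum.cong) auto

lemma place_rook_linear:
  "place_rook s (\<lambda>U. a * f U + b * g U) U = a * place_rook s f U + b * place_rook s g U"
  unfolding place_rook_def by (simp add: sum_distrib_left sum.distrib algebra_simps)

lemma add_row_linear:
  "add_row s (\<lambda>U. a * f U + b * g U) U = a * add_row s f U + b * add_row s g U"
  unfolding add_row_def place_rook_linear by (simp add: algebra_simps)

text \<open>A rook uses up one column, so multiplication by \<open>Q ^ card\<close> commutes with
  \<open>place_rook\<close> up to one factor \<open>Q\<close>. That factor stands on the left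
  because \<open>Q\<close> need not be invertible.\<close>

lemma place_rook_power_card:
  assumes "finite U"
  shows "Q * place_rook s (\<lambda>W. Q ^ card W * f W) U = Q ^ card U * place_rook s f U"
proof -
  have "Q * (rook_weight s U d * (Q ^ card (U - {d}) * f (U - {d})))
      = Q ^ card U * (rook_weight s U d * f (U - {d}))" if "d \<in> U" for d
  proof -
    have "Q ^ card U = Q * Q ^ card (U - {d})"
      using card_Suc_Diff1[OF assms that] by (metis power_Suc)
    then show ?thesis by (simp only: mult_ac)
  qed
  then show ?thesis
    unfolding place_rook_def sum_distrib_left by (rule sum.cong[OF refl])
qed

section \<open>Adding one column to the state\<close>

lemma rook_weight_insert:
  assumes "finite U" "c \<notin> U"
  shows "rook_weight s (insert c U) d = (if cyc_before s c d then Q else 1) * rook_weight s U d"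
proof (cases "cyc_before s c d")
  case True
  then have "{c' \<in> insert c U. cyc_before s c' d} = insert c {c' \<in> U. cyc_before s c' d}" by auto
  with True assms show ?thesis by (simp add: rook_weight_def algebra_simps)
next
  case False
  then have "{c' \<in> insert c U. cyc_before s c' d} = {c' \<in> U. cyc_before s c' d}" by auto
  with False show ?thesis by (simp add: rook_weight_def)
qed

lemma place_rook_insert:
  assumes "finite V" "c \<notin> V"
  shows "place_rook s f (insert c V) = rook_weight s (insert c V) c * f V
    + (\<Sum>d\<in>V. rook_weight s (insert c V) d * f (insert c (V - {d})))"
proof -
  have "insert c V - {d} = insert c (V - {d})" if "d \<in> V" for d using that assms by auto
  moreover have "insert c V - {c} = V" using assms by auto
  ultimately show ?thesis unfolding place_rook_def using assms by simp
qed

text \<open>Here \<open>c\<close> comes first in the cyclic order: no column precedes it, and it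
  precedes all others, so each of their weights gains a factor \<open>Q\<close>.\<close>

lemma place_rook_insert_first:
  assumes "finite V" "c \<notin> V" "s < c" "\<And>d. d \<in> V \<Longrightarrow> s < d \<Longrightarrow> c < d"
  shows "place_rook s f (insert c V) = f V + Q * place_rook s (\<lambda>W. f (insert c W)) V"
proof -
  have "{c' \<in> insert c V. cyc_before s c' c} = {}"
    using assms by (force simp: cyc_before_def)
  then have 1: "rook_weight s (insert c V) c = 1"
    using \<open>s < c\<close> by (simp only: rook_weight_def card.empty) simp
  have "cyc_before s c d" if "d \<in> V" for d
    using assms that by (auto simp: cyc_before_def)
  then have "rook_weight s (insert c V) d = Q * rook_weight s V d" if "d \<in> V" for d
    using that assms by (simp add: rook_weight_insert)
  then show ?thesis
    using assms 1 by (simp add: place_rook_insert) (simp add: place_rook_def sum_distrib_left algebra_simps)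
qed

text \<open>Here \<open>c\<close> comes last in the cyclic order: all of \<open>V\<close> precedes
  it, it precedes nothing, and a rook in it is a hit.\<close>

lemma place_rook_insert_last:
  assumes "finite V" "c \<notin> V" "c \<le> s" "\<And>d. d \<in> V \<Longrightarrow> d \<le> s \<Longrightarrow> d < c"
  shows "place_rook s f (insert c V)
    = x * Q ^ card V * f V + place_rook s (\<lambda>W. f (insert c W)) V"
proof -
  have "{c' \<in> insert c V. cyc_before s c' c} = V"
    using assms by (force simp: cyc_before_def)
  then have 1: "rook_weight s (insert c V) c = x * Q ^ card V"
    using assms by (simp add: rook_weight_def)
  have "\<not> cyc_before s c d" if "d \<in> V" for d
    using assms that by (force simp: cyc_before_def)
  then have "rook_weight s (insert c V) d = rook_weight s V d" if "d \<in> V" for d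
    using that assms by (simp add: rook_weight_insert)
  then show ?thesis
    using assms 1 by (simp add: place_rook_insert) (simp add: place_rook_def)
qed

lemma place_rook_start:
  assumes "\<And>d. d \<in> V \<Longrightarrow> s < d \<longleftrightarrow> t < d"
  shows "place_rook s f V = place_rook t f V"
proof -
  have "{c \<in> V. cyc_before s c d} = {c \<in> V. cyc_before t c d}" if "d \<in> V" for d
    using assms that by (auto simp: cyc_before_def)
  then show ?thesis
    unfolding place_rook_def rook_weight_def using assms by (intro sum.cong) auto
qed

section \<open>The relation nen\<close>

text \<open>The starts \<open>s\<close> and \<open>Suc s\<close> differ only in their treatment of
  column \<open>Suc s\<close>, which is first for the one and last for the other. Without that
  column all three compositions coincide; with it, both rows are expanded around it and an identity
  of ring elements remains.\<close>

lemma nen_add_row: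
  assumes "finite U"
  shows "(1 + Q) * add_row s (add_row (Suc s) f) U
    = Q * add_row (Suc s) (add_row (Suc s) f) U + add_row s (add_row s f) U"
proof -
  let ?a = "Suc s"
  have start: "place_rook s g V = place_rook ?a g V" if "?a \<notin> V" for g V
  proof (rule place_rook_start)
    fix d assume "d \<in> V"
    then have "d \<noteq> ?a" using that by auto
    then show "s < d \<longleftrightarrow> ?a < d" by auto
  qed
  show ?thesis
  proof (cases "?a \<in> U")
    case False
    have *: "add_row s g V = add_row ?a g V" if "?a \<notin> V" for g V
      using start[OF that] by (simp add: add_row_def)
    have "add_row s (add_row t f) U = add_row ?a (add_row ?a f) U" if "t = s \<or> t = ?a" for t
    proof -
      have "add_row s (add_row t f) U = add_row ?a (add_row t f) U" by (rule *[OF False])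
      also have "place_rook ?a (add_row t f) U = place_rook ?a (add_row ?a f) U"
        by (rule place_rook_cong) (use that False * in auto)
      then have "add_row ?a (add_row t f) U = add_row ?a (add_row ?a f) U"
        using *[OF False] that by (auto simp: add_row_def[of ?a "add_row _ f"])
      finally show ?thesis .
    qed
    then show ?thesis by (simp add: algebra_simps)
  next
    case True
    then obtain V where U: "U = insert ?a V" "?a \<notin> V" "finite V"
      using assms by (metis finite_insert mk_disjoint_insert)
    \<comment> \<open>Away from column \<open>?a\<close> both starts give the same operator.\<close>
    define M where "M = place_rook ?a"
    let ?f = "\<lambda>W. f (insert ?a W)"
    have card: "Q ^ card (insert ?a W) = Q * Q ^ card W" if "finite W" "?a \<notin> W" for W
      using that by simp
    have add0: "add_row t g W = Q ^ card W * g W + M g W"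
      if "finite W" "?a \<notin> W" "t = s \<or> t = ?a" for t g W
      using that start by (auto simp: add_row_def M_def)
    have adds: "add_row s g (insert ?a W)
        = Q * Q ^ card W * g (insert ?a W) + g W + Q * M (\<lambda>W. g (insert ?a W)) W"
      if "finite W" "?a \<notin> W" for g W
    proof -
      have "?a < d" if "d \<in> W" "s < d" for d
        using that \<open>?a \<notin> W\<close> by (metis Suc_lessI)
      then show ?thesis
        using that place_rook_insert_first[of W ?a s g] start
        by (simp add: add_row_def M_def)
    qed
    have adda: "add_row ?a g (insert ?a W)
        = Q * Q ^ card W * g (insert ?a W) + x * Q ^ card W * g W + M (\<lambda>W. g (insert ?a W)) W"
      if "finite W" "?a \<notin> W" for g W
    proof -
      have "d < ?a" if "d \<in> W" "d \<le> ?a" for d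
        using that \<open>?a \<notin> W\<close> by (metis le_neq_implies_less)
      then show ?thesis
        using that place_rook_insert_last[of W ?a ?a g]
        by (simp add: add_row_def M_def)
    qed
    have Mcong: "M g V = M h V" if "\<And>W. finite W \<Longrightarrow> ?a \<notin> W \<Longrightarrow> g W = h W" for g h
      unfolding M_def by (rule place_rook_cong) (use that U in auto)
    have Mlin: "M (\<lambda>W. a * g W + b * h W) V = a * M g V + b * M h V" for a b g h
      unfolding M_def by (rule place_rook_linear)
    have MK: "Q * M (\<lambda>W. Q ^ card W * g W) V = Q ^ card V * M g V" for g
      unfolding M_def by (rule place_rook_power_card) (use U in auto)
    have Madds: "M (\<lambda>W. add_row s f (insert ?a W)) V
       = Q ^ card V * M ?f V + M f V + Q * M (M ?f) V"
    proof -
      \<comment> \<open>The factors \<open>1\<close> bring the sum into the two-term shape of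
        \<open>Mlin\<close>.\<close>
      have "M (\<lambda>W. add_row s f (insert ?a W)) V
        = M (\<lambda>W. Q * (Q ^ card W * ?f W) + 1 * (1 * f W + Q * M ?f W)) V"
        by (rule Mcong) (simp add: adds algebra_simps)
      then show ?thesis by (simp only: Mlin MK) (simp add: algebra_simps)
    qed
    \<comment> \<open>The factor \<open>Q\<close> in front lets \<open>MK\<close> reduce the term
      with coefficient \<open>x\<close>.\<close>
    have Madda: "Q * M (\<lambda>W. add_row ?a f (insert ?a W)) V
       = Q * Q ^ card V * M ?f V + x * Q ^ card V * M f V + Q * M (M ?f) V"
    proof -
      have "M (\<lambda>W. add_row ?a f (insert ?a W)) V
        = M (\<lambda>W. Q * (Q ^ card W * ?f W) + 1 * (x * (Q ^ card W * f W) + 1 * M ?f W)) V"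
        by (rule Mcong) (simp add: adda algebra_simps)
      also have "\<dots> = Q ^ card V * M ?f V + x * M (\<lambda>W. Q ^ card W * f W) V + M (M ?f) V"
        by (simp only: Mlin MK) (simp add: algebra_simps)
      also have "Q * \<dots> = Q * Q ^ card V * M ?f V
          + x * (Q * M (\<lambda>W. Q ^ card W * f W) V) + Q * M (M ?f) V"
        by (simp add: algebra_simps)
      finally show ?thesis by (simp only: MK) (simp add: algebra_simps)
    qed
    have L: "add_row s (add_row ?a f) U = Q * Q ^ card V * add_row ?a f (insert ?a V)
        + (Q ^ card V * f V + M f V) + Q * M (\<lambda>W. add_row ?a f (insert ?a W)) V"
      using U by (simp add: adds add0)
    have R1: "Q * add_row ?a (add_row ?a f) U = Q * (Q * Q ^ card V * add_row ?a f (insert ?a V)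
        + x * Q ^ card V * (Q ^ card V * f V + M f V))
        + Q * M (\<lambda>W. add_row ?a f (insert ?a W)) V"
      using U by (simp add: adda[of V "add_row ?a f"] add0 algebra_simps)
    have R2: "add_row s (add_row s f) U = Q * Q ^ card V * add_row s f (insert ?a V)
        + (Q ^ card V * f V + M f V) + Q * M (\<lambda>W. add_row s f (insert ?a W)) V"
      using U by (simp add: adds add0)
    show ?thesis
      unfolding L R1 R2 Madda Madds adda[OF U(3,2)] adds[OF U(3,2)]
      by (simp add: algebra_simps)
  qed
qed

section \<open>The relation ene\<close>

text \<open>The columns \<open>a\<close> and \<open>Suc a\<close> are adjacent, and
  \<open>s \<noteq> a\<close> keeps the start from falling between them. Hence both have the same
  position relative to \<open>V\<close>, and a proportionality of \<open>f\<close> is inherited. The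
  hypothesis on \<open>f V\<close> covers the rook placed in \<open>a\<close> or
  \<open>Suc a\<close> itself; it is applied with \<open>r = 1\<close> or with
  \<open>f V = 0\<close>.\<close>

lemma place_rook_swap:
  assumes "s \<noteq> a" and "finite V" and "a \<notin> V" "Suc a \<notin> V"
    and "f V = r * f V"
    and "\<And>d. d \<in> V \<Longrightarrow> f (insert (Suc a) (V - {d})) = r * f (insert a (V - {d}))"
  shows "place_rook s f (insert (Suc a) V) = r * place_rook s f (insert a V)"
proof -
  have *: "cyc_before s (Suc a) d = cyc_before s a d" if "d \<in> V" for d
  proof -
    have "d \<noteq> a" "d \<noteq> Suc a" using that assms by auto
    then show ?thesis using \<open>s \<noteq> a\<close> by (auto simp: cyc_before_def)
  qed
  have **: "rook_weight s (insert (Suc a) V) (Suc a) = rook_weight s (insert a V) a"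
  proof -
    have "{c \<in> insert (Suc a) V. cyc_before s c (Suc a)} = {c \<in> insert a V. cyc_before s c a}"
      using assms by (auto simp: cyc_before_def less_Suc_eq)
    then show ?thesis using assms by (auto simp: rook_weight_def)
  qed
  have "place_rook s f (insert (Suc a) V) = rook_weight s (insert a V) a * (r * f V) +
     (\<Sum>d\<in>V. rook_weight s (insert a V) d * (r * f (insert a (V - {d}))))"
    using assms(2-4,6) * ** by (simp add: place_rook_insert rook_weight_insert flip: assms(5))
  also have "\<dots> = r * place_rook s f (insert a V)"
    using assms(2-4) by (simp add: place_rook_insert sum_distrib_left algebra_simps)
  finally show ?thesis .
qed

text \<open>Both columns are already at most \<open>s\<close>, and \<open>s\<close> only grows along
  the word, so no later row can tell them apart.\<close>

lemma transfer_swap: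
  assumes "a < s" "finite V" "a \<notin> V" "Suc a \<notin> V"
  shows "transfer w s (insert (Suc a) V) = transfer w s (insert a V)"
  using assms
proof (induction w arbitrary: s V)
  case (Cons l w)
  show ?case
  proof (cases l)
    case N
    have "place_rook s (transfer w s) (insert (Suc a) V) = 1 * place_rook s (transfer w s) (insert a V)"
      by (rule place_rook_swap) (use Cons in auto)
    then show ?thesis using N Cons by (simp add: add_row_def)
  next
    case E
    then show ?thesis using Cons.IH[of "Suc s" V] Cons.prems by simp
  qed
qed auto

text \<open>
  Unlike \<open>nen\<close>, the relation \<open>ene\<close> does not hold for \<^const>\<open>transfer\<close> in every state \<open>U\<close>: its defect
  vanishes if \<open>U\<close> contains both or neither of the two columns involved, and otherwise has the
  following skew-symmetry, which is preserved by adding rows below. The initial state contains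
  both columns.
\<close>

definition skew_pair :: "nat \<Rightarrow> (nat set \<Rightarrow> 'a) \<Rightarrow> bool" where
  "skew_pair a f \<longleftrightarrow> (\<forall>V. finite V \<longrightarrow> a \<notin> V \<longrightarrow> Suc a \<notin> V \<longrightarrow>
     f V = 0 \<and> f (insert a (insert (Suc a) V)) = 0 \<and> f (insert (Suc a) V) = - Q * f (insert a V))"

text \<open>If both columns are open, the weight of \<open>Suc a\<close> is \<open>Q\<close> times
  that of \<open>a\<close>, since exactly \<open>a\<close> is added to the columns before it. This
  cancels against the factor \<open>- Q\<close> of the skew-symmetry. If only one is open,
  \<open>place_rook_swap\<close> applies with \<open>r = - Q\<close>.\<close>

lemma skew_pair_add_row:
  assumes f: "skew_pair a f" and s: "s < a"
  shows "skew_pair a (add_row s f)"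
  unfolding skew_pair_def
proof (intro allI impI conjI)
  fix V :: "nat set" assume V: "finite V" "a \<notin> V" "Suc a \<notin> V"
  have f0: "f W = 0" and fab: "f (insert a (insert (Suc a) W)) = 0"
    and fb: "f (insert (Suc a) W) = - Q * f (insert a W)"
    if "finite W" "a \<notin> W" "Suc a \<notin> W" for W
    using f that by (auto simp: skew_pair_def)
  show "add_row s f V = 0" using V f0 by (simp add: add_row_def place_rook_def)
  have "place_rook s f (insert (Suc a) V) = - Q * place_rook s f (insert a V)"
    by (rule place_rook_swap) (use V s f0 fb in auto)
  then show "add_row s f (insert (Suc a) V) = - Q * add_row s f (insert a V)"
    using V fb[of V] by (simp add: add_row_def algebra_simps)
  let ?U = "insert a (insert (Suc a) V)"
  have "{c \<in> ?U. cyc_before s c (Suc a)} = insert a {c \<in> ?U. cyc_before s c a}"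
    using s by (auto simp: cyc_before_def less_Suc_eq)
  moreover have "a \<notin> {c \<in> ?U. cyc_before s c a}" using s by (auto simp: cyc_before_def)
  ultimately have w: "rook_weight s ?U (Suc a) = Q * rook_weight s ?U a"
    using s V by (simp add: rook_weight_def)
  have "?U - {Suc a} = insert a V" "?U - {a} = insert (Suc a) V" using V by auto
  moreover have "f (?U - {d}) = 0" if "d \<in> V" for d
  proof -
    have "?U - {d} = insert a (insert (Suc a) (V - {d}))" using that V by auto
    then show ?thesis using fab[of "V - {d}"] V by simp
  qed
  ultimately have "place_rook s f ?U = 0"
    unfolding place_rook_def using V w fb[of V] by simp
  then show "add_row s f ?U = 0" using fab V by (simp add: add_row_def)
qed

text \<open>After both letters \<open>E\<close> the two new columns \<open>a\<close> and
  \<open>b\<close> are interchangeable for \<open>f\<close>, which is the hypothesis. The cyclic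
  orders for the three starts are \<open>a, b, V\<close>, then \<open>b, V, a\<close>, then
  \<open>V, a, b\<close>; expanding each \<open>place_rook\<close> accordingly gives the
  claim.\<close>

lemma skew_pair_ene:
  assumes sym: "\<And>V. finite V \<Longrightarrow> Suc s \<notin> V \<Longrightarrow> Suc (Suc s) \<notin> V \<Longrightarrow>
    f (insert (Suc (Suc s)) V) = f (insert (Suc s) V)"
  shows "skew_pair (Suc s)
    (\<lambda>U. (1 + Q) * add_row (Suc s) f U - (Q * add_row (Suc (Suc s)) f U + add_row s f U))"
  unfolding skew_pair_def
proof (intro allI impI)
  let ?a = "Suc s" let ?b = "Suc (Suc s)"
  fix V :: "nat set" assume V: "finite V" "?a \<notin> V" "?b \<notin> V"
  have V': "d < ?a" if "d \<in> V" "d \<le> ?b" for d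
  proof -
    have "d \<noteq> ?a" "d \<noteq> ?b" using that V by auto
    then show ?thesis using that by simp
  qed
  have V'': "?b < d" if "d \<in> V" "s < d" for d
    using that V' by (metis not_less not_less_eq)
  \<comment> \<open>No column of \<open>V\<close> separates the three starts, so they act alike on
    \<open>V\<close>.\<close>
  have start: "place_rook s g V = place_rook ?a g V" "place_rook ?b g V = place_rook ?a g V" for g
    by (rule place_rook_start; use V'' in force)+
  let ?fa = "place_rook ?a (\<lambda>W. f (insert ?a W)) V"
  let ?fab = "place_rook ?a (\<lambda>W. f (insert ?a (insert ?b W))) V"
  have fb: "place_rook ?a (\<lambda>W. f (insert ?b W)) V = ?fa"
    by (rule place_rook_cong) (use V sym in auto)
  have last: "place_rook t g (insert c V) = x * Q ^ card V * g V + place_rook ?a (\<lambda>W. g (insert c W)) V"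
    if "c \<le> t" "s < c" "t \<le> ?b" "t = ?a \<or> t = ?b" "c = ?a \<or> c = ?b" for t c g
  proof -
    have "place_rook t g (insert c V) = x * Q ^ card V * g V + place_rook t (\<lambda>W. g (insert c W)) V"
    proof (rule place_rook_insert_last)
      fix d assume "d \<in> V" "d \<le> t"
      then show "d < c" using V'[of d] that by linarith
    qed (use V that in auto)
    then show ?thesis using start(2) that by auto
  qed
  have first: "place_rook t g (insert c V) = g V + Q * place_rook ?a (\<lambda>W. g (insert c W)) V"
    if "t < c" "t = s \<or> t = ?a" "c = ?a \<or> c = ?b" for t c g
  proof -
    have "place_rook t g (insert c V) = g V + Q * place_rook t (\<lambda>W. g (insert c W)) V"
    proof (rule place_rook_insert_first)
      fix d assume "d \<in> V" "t < d"
      then show "c < d" using V''[of d] that by linarith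
    qed (use V that in auto)
    then show ?thesis using start(1) that by auto
  qed
  \<comment> \<open>With both columns open, an end column of the cyclic order is peeled off first;
    \<open>last\<close> and \<open>first\<close> then deal with the other one.\<close>
  have b': "place_rook ?b f (insert ?b (insert ?a V))
      = x * Q ^ card (insert ?a V) * f (insert ?a V)
        + place_rook ?b (\<lambda>W. f (insert ?b W)) (insert ?a V)"
    by (rule place_rook_insert_last) (use V V' in force)+
  have a': "place_rook ?a f (insert ?a (insert ?b V))
      = x * Q ^ card (insert ?b V) * f (insert ?b V)
        + place_rook ?a (\<lambda>W. f (insert ?a W)) (insert ?b V)"
    by (rule place_rook_insert_last) (use V V' in force)+
  have s': "place_rook s f (insert ?a (insert ?b V))
      = f (insert ?b V) + Q * place_rook s (\<lambda>W. f (insert ?a W)) (insert ?b V)"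
    by (rule place_rook_insert_first) (use V in \<open>auto dest!: V''\<close>)
  have ba: "insert ?b (insert ?a W) = insert ?a (insert ?b W)" for W by auto
  have "place_rook ?b f (insert ?a (insert ?b V))
      = x * Q * Q ^ card V * f (insert ?a V) + x * Q ^ card V * f (insert ?b V) + ?fab"
    using b' V last[of ?a ?b "\<lambda>W. f (insert ?b W)"] by (simp add: ba)
  moreover have "place_rook ?a f (insert ?a (insert ?b V))
      = x * Q * Q ^ card V * f (insert ?b V) + f (insert ?a V) + Q * ?fab"
    using a' V first[of ?a ?b "\<lambda>W. f (insert ?a W)"] by simp
  moreover have "place_rook s f (insert ?a (insert ?b V))
      = f (insert ?b V) + Q * (f (insert ?a V) + Q * ?fab)"
    using s' V first[of s ?b "\<lambda>W. f (insert ?a W)"] by simp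
  moreover have "f (insert ?b V) = f (insert ?a V)" using sym V by simp
  moreover note last[of ?a ?a f] last[of ?a ?b f] first[of s ?a f]
    first[of ?a ?b f] last[of ?b ?b f] first[of s ?b f]
  ultimately show "(1 + Q) * add_row ?a f V - (Q * add_row ?b f V + add_row s f V) = 0 \<and>
     (1 + Q) * add_row ?a f (insert ?a (insert ?b V)) -
     (Q * add_row ?b f (insert ?a (insert ?b V)) + add_row s f (insert ?a (insert ?b V))) = 0 \<and>
     (1 + Q) * add_row ?a f (insert ?b V) - (Q * add_row ?b f (insert ?b V) + add_row s f (insert ?b V)) =
     - Q * ((1 + Q) * add_row ?a f (insert ?a V) -
       (Q * add_row ?b f (insert ?a V) + add_row s f (insert ?a V)))"
    using V start fb by (simp add: add_row_def algebra_simps)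
qed

section \<open>The relations inside arbitrary words\<close>

text \<open>The row identity \<open>nen_add_row\<close> holds in every finite state, and adding rows
  is linear, so any prefix \<open>u\<close> preserves it.\<close>

lemma transfer_nen:
  assumes "finite U"
  shows "(1 + Q) * transfer (u @ [N, E, N] @ w) s U
    = Q * transfer (u @ [E, N, N] @ w) s U + transfer (u @ [N, N, E] @ w) s U"
  using assms
proof (induction u arbitrary: s U)
  case Nil
  then show ?case using nen_add_row[of U s "transfer w (Suc s)"] by simp
next
  case (Cons l u)
  show ?case
  proof (cases l)
    case N
    let ?F = "\<lambda>v. transfer (u @ v @ w) s"
    \<comment> \<open>The summand with factor \<open>0\<close> gives the left side the two-term
      shape of \<open>add_row_linear\<close>.\<close>
    have *: "(1 + Q) * ?F [N, E, N] W + 0 * ?F [N, N, E] W = Q * ?F [E, N, N] W + 1 * ?F [N, N, E] W"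
      if "finite W" for W
      using Cons.IH[OF that] by simp
    have "place_rook s (\<lambda>W. (1 + Q) * ?F [N, E, N] W + 0 * ?F [N, N, E] W) U
        = place_rook s (\<lambda>W. Q * ?F [E, N, N] W + 1 * ?F [N, N, E] W) U"
      by (rule place_rook_cong) (use * Cons.prems in auto)
    then have "add_row s (\<lambda>W. (1 + Q) * ?F [N, E, N] W + 0 * ?F [N, N, E] W) U
        = add_row s (\<lambda>W. Q * ?F [E, N, N] W + 1 * ?F [N, N, E] W) U"
      using *[OF Cons.prems] by (simp only: add_row_def)
    then show ?thesis unfolding add_row_linear using N by simp
  qed (use Cons in auto)
qed

text \<open>Prefix letters \<open>N\<close> are rows whose start lies before the two columns of the
  relator, so \<open>skew_pair_add_row\<close> applies; a letter \<open>E\<close> only moves the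
  start.\<close>

lemma transfer_ene_skew:
  "skew_pair (Suc (s + count_list u E)) (\<lambda>U. (1 + Q) * transfer (u @ [E, N, E] @ w) s U
    - (Q * transfer (u @ [E, E, N] @ w) s U + transfer (u @ [N, E, E] @ w) s U))"
proof (induction u arbitrary: s)
  case Nil
  show ?case
    using skew_pair_ene[of s "transfer w (Suc (Suc s))"] transfer_swap[of "Suc s" "Suc (Suc s)"]
    by simp
next
  case (Cons l u)
  show ?case
  proof (cases l)
    case N
    let ?F = "\<lambda>v. transfer (u @ v @ w) s"
    let ?D = "\<lambda>U. (1 + Q) * ?F [E, N, E] U + (-1) * (Q * ?F [E, E, N] U + 1 * ?F [N, E, E] U)"
    have "skew_pair (Suc (s + count_list u E)) ?D"
      using Cons.IH[of s] by (simp add: algebra_simps)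
    then have "skew_pair (Suc (s + count_list u E)) (add_row s ?D)"
      by (rule skew_pair_add_row) simp
    moreover have "add_row s ?D = (\<lambda>U. (1 + Q) * add_row s (?F [E, N, E]) U
       + (-1) * (Q * add_row s (?F [E, E, N]) U + 1 * add_row s (?F [N, E, E]) U))"
      by (rule ext) (simp only: add_row_linear)
    ultimately show ?thesis using N by (simp add: algebra_simps)
  next
    case E
    then show ?thesis using Cons.IH[of "Suc s"] by simp
  qed
qed

lemma transfer_ene:
  assumes "n = count_list (u @ [E, N, E] @ w) E"
  shows "(1 + Q) * transfer (u @ [E, N, E] @ w) 0 {1..n}
    = Q * transfer (u @ [E, E, N] @ w) 0 {1..n} + transfer (u @ [N, E, E] @ w) 0 {1..n}"
proof -
  let ?a = "Suc (count_list u E)"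
  have "{1..n} = insert ?a (insert (Suc ?a) ({1..n} - {?a, Suc ?a}))"
    using assms by auto
  moreover have "finite ({1..n} - {?a, Suc ?a})" "?a \<notin> {1..n} - {?a, Suc ?a}"
    "Suc ?a \<notin> {1..n} - {?a, Suc ?a}" by auto
  ultimately have "(1 + Q) * transfer (u @ [E, N, E] @ w) 0 {1..n}
    - (Q * transfer (u @ [E, E, N] @ w) 0 {1..n} + transfer (u @ [N, E, E] @ w) 0 {1..n}) = 0"
    using transfer_ene_skew[of 0 u w] unfolding skew_pair_def by (metis add_0)
  then show ?thesis by simp
qed

section \<open>Rectangular words and falling products of q-integers\<close>

text \<open>The analogue of \<open>qint\<close> over a general ring, later taken at the constant
  polynomial \<open>[:q:]\<close>.\<close>

definition qnum :: "nat \<Rightarrow> 'a" where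
  "qnum j = (\<Sum>i<j. Q ^ i)"

lemma qnum_add: "qnum (a + b) = qnum a + Q ^ a * qnum b"
  unfolding qnum_def by (induction b) (auto simp: algebra_simps power_add)

text \<open>The ranks of the elements of \<open>U\<close> run through
  \<open>0, ..., card U - 1\<close>.\<close>

lemma sum_power_rank:
  fixes U :: "nat set"
  assumes "finite U"
  shows "(\<Sum>d\<in>U. Q ^ card {c \<in> U. c < d}) = qnum (card U)"
  using assms
proof (induction U rule: finite_linorder_max_induct)
  case (insert b A)
  have "{c \<in> insert b A. c < d} = {c \<in> A. c < d}" if "d \<in> A" for d
    using insert that by auto
  moreover have "{c \<in> insert b A. c < b} = A" "b \<notin> A" using insert by auto
  ultimately show ?case using insert qnum_add[of "card A" 1] by (simp add: qnum_def)
qed (simp add: qnum_def)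

text \<open>The columns beyond \<open>s\<close> take the first ranks and those up to
  \<open>s\<close> the remaining ones, so the two partial sums join by
  \<open>qnum_add\<close>.\<close>

lemma sum_power_cyclic_rank:
  assumes "finite U"
  shows "(\<Sum>d\<in>U. Q ^ card {c \<in> U. cyc_before s c d}) = qnum (card U)"
proof -
  let ?A = "{c \<in> U. s < c}" and ?B = "{c \<in> U. c \<le> s}"
  have U: "U = ?A \<union> ?B" "?A \<inter> ?B = {}" "finite ?A" "finite ?B" using assms by auto
  have "{c \<in> U. cyc_before s c d} = {c \<in> ?A. c < d}" if "d \<in> ?A" for d
    using that by (auto simp: cyc_before_def)
  then have A: "(\<Sum>d\<in>?A. Q ^ card {c \<in> U. cyc_before s c d}) = qnum (card ?A)"
    using sum_power_rank[OF U(3)] by simp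
  have "card {c \<in> U. cyc_before s c d} = card ?A + card {c \<in> ?B. c < d}" if "d \<in> ?B" for d
  proof -
    have "{c \<in> U. cyc_before s c d} = ?A \<union> {c \<in> ?B. c < d}"
      using that by (auto simp: cyc_before_def)
    moreover have "?A \<inter> {c \<in> ?B. c < d} = {}" by auto
    ultimately show ?thesis using U(3,4) by (simp add: card_Un_disjoint)
  qed
  then have B: "(\<Sum>d\<in>?B. Q ^ card {c \<in> U. cyc_before s c d}) = Q ^ card ?A * qnum (card ?B)"
    using sum_power_rank[OF U(4)] by (simp add: power_add flip: sum_distrib_left)
  have "(\<Sum>d\<in>?A \<union> ?B. Q ^ card {c \<in> U. cyc_before s c d}) = qnum (card ?A + card ?B)"
    using A B U(2-4) by (simp add: sum.union_disjoint qnum_add)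
  moreover have "card U = card ?A + card ?B" using U by (metis card_Un_disjoint)
  ultimately show ?thesis using U(1) by simp
qed

text \<open>The top factor is split as \<open>[m + 1] = [u + 1] + Q ^ (u + 1) [m - u]\<close>. The
  two summands will match a bottom row without and with a rook.\<close>

lemma qnum_falling_Suc:
  "(\<Prod>l<Suc u. qnum (Suc m - l))
     = Q ^ Suc u * (\<Prod>l<Suc u. qnum (m - l)) + qnum (Suc u) * (\<Prod>l<u. qnum (m - l))"
proof (cases "u \<le> m")
  case True
  then have "qnum (Suc m) = qnum (Suc u) + Q ^ Suc u * qnum (m - u)"
    using qnum_add[of "Suc u" "m - u"] by simp
  then show ?thesis
    by (subst prod.lessThan_Suc_shift) (simp add: algebra_simps)
next
  case False
  \<comment> \<open>The factor at \<open>l = m\<close> is \<open>qnum 0 = 0\<close>, so both sides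
    vanish.\<close>
  then have "(\<Prod>l<u. qnum (m - l)) = 0"
    by (intro prod_zero bexI[of _ m]) (auto simp: qnum_def)
  then show ?thesis by (subst prod.lessThan_Suc_shift) simp
qed

text \<open>All rows have the same start \<open>s\<close>, so hits depend only on the columns:
  precisely those up to \<open>s\<close> contribute an \<open>x\<close>. Within a row the remaining
  weights sum to a q-integer.\<close>

lemma transfer_rectangle:
  assumes "finite U" "\<And>c. c \<in> U \<Longrightarrow> 0 < c"
  shows "transfer (replicate m N @ replicate b E) s U
    = (\<Prod>l<card U. qnum (m - l)) * x ^ card {c \<in> U. c \<le> s}"
  using assms
proof (induction m arbitrary: U)
  case 0
  have "transfer (replicate b E) s U = (if U = {} then 1 else 0)"
    using transfer_append_E[of b "[]" s] by simp
  moreover have "(\<Prod>l<card U. qnum (0 - l)) = 0" if "U \<noteq> {}"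
    using that 0 by (intro prod_zero bexI[of _ 0]) (auto simp: qnum_def card_gt_0_iff)
  ultimately show ?case by simp
next
  case (Suc m)
  let ?P = "\<lambda>u. \<Prod>l<u. qnum (m - l)" and ?i = "card {c \<in> U. c \<le> s}"
  show ?case
  proof (cases "U = {}")
    case True
    then show ?thesis using Suc.IH[of "{}"] by (simp add: add_row_def place_rook_def)
  next
    case False
    then obtain u where u: "card U = Suc u"
      using Suc.prems by (metis card_eq_0_iff not0_implies_Suc)
    have "rook_weight s U d * transfer (replicate m N @ replicate b E) s (U - {d})
        = Q ^ card {c \<in> U. cyc_before s c d} * (?P u * x ^ ?i)" if d: "d \<in> U" for d
    proof -
      have IH: "transfer (replicate m N @ replicate b E) s (U - {d})
          = ?P u * x ^ card {c \<in> U - {d}. c \<le> s}"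
        using Suc.IH[of "U - {d}"] Suc.prems d u by simp
      show ?thesis
      proof (cases "s < d")
        case True
        then have "{c \<in> U - {d}. c \<le> s} = {c \<in> U. c \<le> s}" by auto
        then show ?thesis using IH True by (simp add: rook_weight_def)
      next
        case False
        then have "{c \<in> U. c \<le> s} = insert d {c \<in> U - {d}. c \<le> s}" using d by auto
        then have "?i = Suc (card {c \<in> U - {d}. c \<le> s})" using Suc.prems by simp
        then show ?thesis using IH False by (simp add: rook_weight_def algebra_simps)
      qed
    qed
    then have "place_rook s (transfer (replicate m N @ replicate b E) s) U
        = qnum (Suc u) * (?P u * x ^ ?i)"
      using sum_power_cyclic_rank[of U s] Suc.prems u
      by (simp add: place_rook_def flip: sum_distrib_right)
    then show ?thesis
      using Suc.IH[of U] Suc.prems u qnum_falling_Suc[of m u]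
      by (simp add: add_row_def algebra_simps del: prod.lessThan_Suc)
  qed
qed

end

section \<open>Rook placements\<close>

text \<open>The column set is arbitrary, unlike in \<open>rook_placements\<close>, so that deleting
  the bottom row together with the column of its rook stays within the family.\<close>

definition placements :: "nat \<Rightarrow> nat set \<Rightarrow> (nat \<times> nat) set set" where
  "placements m U = {p. p \<subseteq> {1..m} \<times> U \<and> (\<forall>c\<in>U. \<exists>!r. (r, c) \<in> p) \<and>
     (\<forall>r c c'. (r, c) \<in> p \<longrightarrow> (r, c') \<in> p \<longrightarrow> c = c')}"

text \<open>
  The two row conditions of \<^const>\<open>unattacked\<close> are one cyclic condition: walking from the cell to the
  left, wrapping around from column \<open>1\<close> to the last one, until the boundary of the Ferrers board
  is reached, one meets no rook.
\<close>

definition free_cells :: "nat \<Rightarrow> nat set \<Rightarrow> (nat \<Rightarrow> nat) \<Rightarrow> (nat \<times> nat) set \<Rightarrow> (nat \<times> nat) set" where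
  "free_cells m U lam p = {(r, c) \<in> {1..m} \<times> U.
     (\<forall>r'\<ge>r. (r', c) \<notin> p) \<and> (\<forall>c'. (r, c') \<in> p \<longrightarrow> \<not> cyc_before (lam r) c' c)}"

definition hits :: "(nat \<Rightarrow> nat) \<Rightarrow> (nat \<times> nat) set \<Rightarrow> (nat \<times> nat) set" where
  "hits lam p = {(r, c) \<in> p. c \<le> lam r}"

definition rook_sum :: "'a::comm_ring_1 \<Rightarrow> 'a \<Rightarrow> nat \<Rightarrow> (nat \<Rightarrow> nat) \<Rightarrow> nat set \<Rightarrow> 'a" where
  "rook_sum Q x m lam U =
     (\<Sum>p\<in>placements m U. Q ^ card (free_cells m U lam p) * x ^ card (hits lam p))"

lemma finite_placements: "finite U \<Longrightarrow> finite (placements m U)"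
  by (rule finite_subset[of _ "Pow ({1..m} \<times> U)"]) (auto simp: placements_def)

lemma finite_placement: "finite U \<Longrightarrow> p \<in> placements m U \<Longrightarrow> finite p"
  by (rule finite_subset[of _ "{1..m} \<times> U"]) (auto simp: placements_def)

lemma placement_row: "p \<in> placements m U \<Longrightarrow> (r, c) \<in> p \<Longrightarrow> 1 \<le> r \<and> r \<le> m \<and> c \<in> U"
  by (auto simp: placements_def)

section \<open>Splitting off the bottom row\<close>

lemma placements_Suc:
  "placements (Suc m) U
     = placements m U \<union> (\<Union>d\<in>U. insert (Suc m, d) ` placements m (U - {d}))" (is "?L = ?R")
proof
  show "?L \<subseteq> ?R"
  proof
    fix p assume p: "p \<in> ?L"
    then have sub: "p \<subseteq> {1..Suc m} \<times> U" and col: "\<And>c. c \<in> U \<Longrightarrow> \<exists>!r. (r, c) \<in> p"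
      and row: "\<And>r c c'. (r, c) \<in> p \<Longrightarrow> (r, c') \<in> p \<Longrightarrow> c = c'"
      by (auto simp: placements_def)
    show "p \<in> ?R"
    proof (cases "\<exists>d. (Suc m, d) \<in> p")
      case False
      then have "p \<subseteq> {1..m} \<times> U" using sub by (force simp: le_Suc_eq)
      then show ?thesis using p by (auto simp: placements_def)
    next
      case True
      then obtain d where d: "(Suc m, d) \<in> p" by blast
      then have "d \<in> U" using sub by auto
      let ?p = "p - {(Suc m, d)}"
      have "r \<in> {1..m} \<and> c \<in> U - {d}" if rc: "(r, c) \<in> ?p" for r c
      proof -
        have "r \<noteq> Suc m" using row d rc by auto
        moreover have "c \<noteq> d" using col[OF \<open>d \<in> U\<close>] d rc by auto
        moreover have "r \<in> {1..Suc m}" "c \<in> U" using rc sub by auto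
        ultimately show ?thesis by auto
      qed
      then have "?p \<subseteq> {1..m} \<times> (U - {d})" by (intro subrelI SigmaI) blast+
      moreover have "\<exists>!r. (r, c) \<in> ?p" if "c \<in> U - {d}" for c using col that by auto
      ultimately have "?p \<in> placements m (U - {d})"
        using row unfolding placements_def by blast
      moreover have "p = insert (Suc m, d) ?p" using d by auto
      ultimately show ?thesis using \<open>d \<in> U\<close> by blast
    qed
  qed
  show "?R \<subseteq> ?L"
  proof
    fix p assume "p \<in> ?R"
    then consider "p \<in> placements m U"
      | d p' where "d \<in> U" "p = insert (Suc m, d) p'" "p' \<in> placements m (U - {d})"
      by blast
    then show "p \<in> ?L"
    proof cases
      case 1
      then have "p \<subseteq> {1..m} \<times> U" by (simp add: placements_def)
      also have "\<dots> \<subseteq> {1..Suc m} \<times> U" by auto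
      finally show ?thesis using 1 by (simp add: placements_def)
    next
      case 2
      have "\<exists>!r. (r, c) \<in> p" if "c \<in> U" for c
      proof (cases "c = d")
        case True
        then show ?thesis using 2 placement_row[OF 2(3)] by auto
      next
        case False
        then have "\<exists>!r. (r, c) \<in> p'" using 2 that by (simp add: placements_def)
        then show ?thesis using 2(2) False by auto
      qed
      moreover have "p \<subseteq> {1..Suc m} \<times> U"
        using 2 placement_row[OF 2(3)] by (intro subrelI) fastforce
      moreover have "c = c'" if "(r, c) \<in> p" "(r, c') \<in> p" for r c c'
      proof -
        have "(Suc m, c) \<notin> p'" for c using placement_row[OF 2(3)] by fastforce
        moreover have "c = c'" if "(r, c) \<in> p'" "(r, c') \<in> p'" for r c c'
          using 2(3) that unfolding placements_def by blast
        ultimately show ?thesis using 2(2) that by blast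
      qed
      ultimately show ?thesis unfolding placements_def by blast
    qed
  qed
qed

lemma card_row: "finite C \<Longrightarrow> card ({r} \<times> C) = card C"
  by (simp add: card_cartesian_product)

lemma free_cells_empty_row:
  assumes "finite U" "p \<in> placements m U"
  shows "card (free_cells (Suc m) U lam p) = card U + card (free_cells m U lam p)"
proof -
  have "free_cells (Suc m) U lam p = {Suc m} \<times> U \<union> free_cells m U lam p"
    using placement_row[OF assms(2)] by (fastforce simp: free_cells_def le_Suc_eq)
  moreover have "finite (free_cells m U lam p)"
    using assms by (auto simp: free_cells_def intro: finite_subset[of _ "{1..m} \<times> U"])
  moreover have "({Suc m} \<times> U) \<inter> free_cells m U lam p = {}" by (auto simp: free_cells_def)
  ultimately show ?thesis using assms by (simp add: card_Un_disjoint card_row)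
qed

text \<open>The new rook lies below every other cell of column \<open>d\<close> and thus removes
  that column from all higher rows. In its own row it leaves the cells met before
  \<open>d\<close>.\<close>

lemma free_cells_insert:
  assumes "finite U" "d \<in> U" "p \<in> placements m (U - {d})"
  shows "card (free_cells (Suc m) U lam (insert (Suc m, d) p))
    = card {c \<in> U. cyc_before (lam (Suc m)) c d} + card (free_cells m (U - {d}) lam p)"
proof -
  let ?C = "{c \<in> U. cyc_before (lam (Suc m)) c d}"
  have row: "(Suc m, c) \<notin> p" "(r, d) \<notin> p" for r c using placement_row[OF assms(3)] by fastforce+
  \<comment> \<open>The cyclic order is a strict total order: not coming after \<open>d\<close>
    means coming before it or being \<open>d\<close>.\<close>
  have cyc: "cyc_before s c d \<longleftrightarrow> c \<noteq> d \<and> \<not> cyc_before s d c" for s c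
    by (auto simp: cyc_before_def)
  have high: "(r', c) \<notin> p" if "Suc m \<le> r'" for r' c using placement_row[OF assms(3)] that by fastforce
  have "(r, c) \<in> free_cells (Suc m) U lam (insert (Suc m, d) p)
    \<longleftrightarrow> (r, c) \<in> {Suc m} \<times> ?C \<union> free_cells m (U - {d}) lam p" for r c
  proof (cases "r = Suc m")
    case True
    then show ?thesis using row high cyc[of _ c] assms by (auto simp: free_cells_def)
  next
    case False
    then show ?thesis using row by (auto simp: free_cells_def)
  qed
  then have "free_cells (Suc m) U lam (insert (Suc m, d) p)
    = {Suc m} \<times> ?C \<union> free_cells m (U - {d}) lam p" by auto
  moreover have "finite (free_cells m (U - {d}) lam p)"
    using assms by (auto simp: free_cells_def intro: finite_subset[of _ "{1..m} \<times> U"])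
  moreover have "({Suc m} \<times> ?C) \<inter> free_cells m (U - {d}) lam p = {}"
    by (auto simp: free_cells_def)
  ultimately show ?thesis using assms by (simp add: card_Un_disjoint card_row)
qed

lemma card_hits_insert:
  assumes "finite U" "p \<in> placements m (U - {d})"
  shows "card (hits lam (insert (Suc m, d) p)) = (if d \<le> lam (Suc m) then 1 else 0) + card (hits lam p)"
proof -
  have "finite (hits lam p)"
    using finite_placement[OF _ assms(2)] assms(1)
    by (auto simp: hits_def intro: finite_subset[of _ p])
  moreover have "(Suc m, d) \<notin> hits lam p"
    using placement_row[OF assms(2)] by (auto simp: hits_def)
  moreover have "hits lam (insert (Suc m, d) p)
      = (if d \<le> lam (Suc m) then insert (Suc m, d) (hits lam p) else hits lam p)"
    by (auto simp: hits_def)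
  ultimately show ?thesis by simp
qed

text \<open>The rook of the bottom row, or its absence, separates the pieces of
  \<open>placements_Suc\<close>, so the sum splits into disjoint parts, which are the summands of
  \<open>add_row\<close>.\<close>

lemma rook_sum_Suc:
  assumes "finite U"
  shows "rook_sum Q x (Suc m) lam U = add_row Q x (lam (Suc m)) (rook_sum Q x m lam) U"
proof -
  let ?w = "\<lambda>p. Q ^ card (free_cells (Suc m) U lam p) * x ^ card (hits lam p)"
  let ?B = "\<lambda>d. insert (Suc m, d) ` placements m (U - {d})"
  have row: "(Suc m, c) \<notin> p" if "p \<in> placements m V" for p c V
    using placement_row[OF that] by fastforce
  have "sum ?w (?B d) = rook_weight Q x (lam (Suc m)) U d * rook_sum Q x m lam (U - {d})"
    if "d \<in> U" for d
  proof -
    have "inj_on (insert (Suc m, d)) (placements m (U - {d}))"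
      by (rule inj_onI) (metis row insert_ident)
    then have "sum ?w (?B d) = (\<Sum>p\<in>placements m (U - {d}). ?w (insert (Suc m, d) p))"
      by (simp add: sum.reindex)
    also have "\<dots> = (\<Sum>p\<in>placements m (U - {d}). rook_weight Q x (lam (Suc m)) U d *
        (Q ^ card (free_cells m (U - {d}) lam p) * x ^ card (hits lam p)))"
      using assms that
      by (intro sum.cong)
        (auto simp: free_cells_insert card_hits_insert rook_weight_def power_add)
    finally show ?thesis by (simp add: rook_sum_def sum_distrib_left)
  qed
  moreover have "sum ?w (\<Union>d\<in>U. ?B d) = (\<Sum>d\<in>U. sum ?w (?B d))"
  proof (rule sum.UNION_disjoint)
    show "\<forall>d\<in>U. finite (?B d)" using assms by (simp add: finite_placements)
    show "\<forall>d\<in>U. \<forall>d'\<in>U. d \<noteq> d' \<longrightarrow> ?B d \<inter> ?B d' = {}" using row by blast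
  qed (fact assms)
  moreover have "sum ?w (placements m U) = Q ^ card U * rook_sum Q x m lam U"
    unfolding rook_sum_def sum_distrib_left
    using assms by (intro sum.cong) (auto simp: free_cells_empty_row power_add mult.assoc)
  moreover have "sum ?w (placements (Suc m) U) = sum ?w (placements m U) + sum ?w (\<Union>d\<in>U. ?B d)"
    unfolding placements_Suc
    by (rule sum.union_disjoint) (use assms row in \<open>auto simp: finite_placements\<close>)
  ultimately show ?thesis
    by (simp add: rook_sum_def[of Q x "Suc m"] add_row_def place_rook_def)
qed

lemma rook_sum_0: "rook_sum Q x 0 lam U = (if U = {} then 1 else 0)"
proof -
  have "placements 0 U = (if U = {} then {{}} else {})" by (auto simp: placements_def)
  then show ?thesis by (auto simp: rook_sum_def free_cells_def hits_def)
qed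

lemma rook_sum_cong:
  assumes "\<And>i. i \<in> {1..m} \<Longrightarrow> lam i = mu i"
  shows "rook_sum Q x m lam U = rook_sum Q x m mu U"
  unfolding rook_sum_def
proof (rule sum.cong[OF refl])
  fix p assume p: "p \<in> placements m U"
  have "free_cells m U lam p = free_cells m U mu p"
    using assms by (auto simp: free_cells_def)
  moreover have "lam r = mu r" if "(r, c) \<in> p" for r c
    using assms placement_row[OF p that] by simp
  then have "hits lam p = hits mu p" by (auto simp: hits_def)
  ultimately show "Q ^ card (free_cells m U lam p) * x ^ card (hits lam p)
      = Q ^ card (free_cells m U mu p) * x ^ card (hits mu p)" by simp
qed

text \<open>A leading \<open>N\<close> is the bottom row, of remaining length 0. A leading
  \<open>E\<close> shortens all remaining rows by 1, which the shift by \<open>s\<close>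
  compensates.\<close>

lemma transfer_eq_rook_sum:
  assumes "is_word_of m n lam w" "finite U"
  shows "transfer Q x w s U = rook_sum Q x m (\<lambda>i. lam i + s) U"
  using assms
proof (induction w arbitrary: m n lam s U)
  case Nil
  then show ?case by (simp add: is_word_of_def rook_sum_0)
next
  case (Cons l w)
  show ?case
  proof (cases l)
    case N
    then obtain m' where m: "m = Suc m'" "lam m = 0" and w: "is_word_of m' n lam w"
      using Cons.prems by (auto simp: is_word_of_N_iff)
    have IH: "transfer Q x w s V = rook_sum Q x m' (\<lambda>i. lam i + s) V" if "finite V" for V
      using Cons.IH[OF w that] .
    have "place_rook Q x s (transfer Q x w s) U
        = place_rook Q x s (rook_sum Q x m' (\<lambda>i. lam i + s)) U"
      by (rule place_rook_cong) (use IH Cons.prems in simp)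
    then show ?thesis
      using N m IH Cons.prems by (simp add: rook_sum_Suc add_row_def)
  next
    case E
    then obtain n' where pos: "\<forall>i\<in>{1..m}. lam i > 0" and w: "is_word_of m n' (\<lambda>i. lam i - 1) w"
      using Cons.prems by (auto simp: is_word_of_E_iff)
    have "transfer Q x w (Suc s) U = rook_sum Q x m (\<lambda>i. lam i - 1 + Suc s) U"
      using Cons.IH[OF w] Cons.prems by blast
    \<comment> \<open>The truncated difference is harmless only on rows \<open>1..m\<close>, where
      \<open>lam i\<close> is positive.\<close>
    also have "\<dots> = rook_sum Q x m (\<lambda>i. lam i + s) U"
      by (rule rook_sum_cong) (use pos in force)
    finally show ?thesis using E by simp
  qed
qed

text \<open>With \<open>x\<close> the polynomial variable and \<open>Q\<close> constant, taking the
  coefficient of degree \<open>k\<close> selects the placements with \<open>k\<close> hits.\<close>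

lemma coeff_rook_sum: "coeff (rook_sum [:q:] [:0, 1:] m lam {1..n}) k = hit_number m n lam k"
proof -
  have "stat m n lam p = card (free_cells m {1..n} lam p)"
    "card (p \<inter> cells m n lam) = card (hits lam p)" if p: "p \<in> placements m {1..n}" for p
  proof -
    have sub: "r \<in> {1..m} \<and> c \<in> {1..n}" if "(r, c) \<in> p" for r c
      using p that by (auto simp: placements_def)
    have cell: "(r, c) \<in> cells m n lam \<longleftrightarrow> c \<le> lam r" if "(r, c) \<in> p \<or> (r, c) \<in> board m n" for r c
      using sub that by (auto simp: cells_def board_def)
    have "p \<inter> cells m n lam = hits lam p" using cell by (auto simp: hits_def)
    then show "card (p \<inter> cells m n lam) = card (hits lam p)" by simp
    have "unattacked m n lam p r c \<longleftrightarrow>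
      (\<forall>r'\<ge>r. (r', c) \<notin> p) \<and> (\<forall>c'. (r, c') \<in> p \<longrightarrow> \<not> cyc_before (lam r) c' c)"
      if rc: "(r, c) \<in> board m n" for r c
    proof -
      \<comment> \<open>For a rook in row \<open>r\<close>, lying outside the Ferrers board means
        lying beyond \<open>lam r\<close>; this turns the two row conditions into
        \<open>cyc_before\<close>.\<close>
      have 1: "(r, c') \<in> p - cells m n lam \<longleftrightarrow> (r, c') \<in> p \<and> lam r < c'" for c'
        using cell[of r c'] by auto
      have 2: "(\<forall>r'\<ge>r. (r', c) \<notin> p) \<longleftrightarrow> (r, c) \<notin> p \<and> (\<forall>r'>r. (r', c) \<notin> p)"
        by (auto simp: order_le_less)
      show ?thesis
        unfolding unattacked_def 1 2 cyc_before_def using cell[of r c] rc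
        by (cases "c \<le> lam r") (auto, meson le_less_trans)
    qed
    then have "{(r, c) \<in> board m n. unattacked m n lam p r c} = free_cells m {1..n} lam p"
      by (auto simp: free_cells_def board_def)
    then show "stat m n lam p = card (free_cells m {1..n} lam p)" by (simp add: stat_def)
  qed
  moreover have "placements m {1..n} = rook_placements m n"
    by (simp add: placements_def rook_placements_def board_def)
  moreover have "coeff ([:q:] ^ a * [:0, 1:] ^ b) k = (if b = k then q ^ a else 0)" for a b
  proof -
    have "[:0, 1:] ^ b = monom (1 :: ratfun) b" by (simp only: monom_altdef smult_1_left)
    then show ?thesis by (simp add: poly_const_pow)
  qed
  ultimately have "coeff (rook_sum [:q:] [:0, 1:] m lam {1..n}) k
      = (\<Sum>p\<in>rook_placements m n. if card (p \<inter> cells m n lam) = k then q ^ stat m n lam p else 0)"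
    unfolding rook_sum_def coeff_sum by (intro sum.cong) auto
  also have "\<dots> = hit_number m n lam k"
    unfolding hit_number_def hit_placements_def
    using finite_placements[of "{1..n}" m] \<open>placements m {1..n} = rook_placements m n\<close>
    by (simp add: sum.inter_filter)
  finally show ?thesis .
qed

section \<open>Spanning words of the path algebra\<close>

lemma free_alg_induct [case_names single add]:
  fixes p :: free_alg
  assumes "\<And>w c. P (Poly_Mapping.single w c)" and "\<And>p r. P p \<Longrightarrow> P r \<Longrightarrow> P (p + r)"
  shows "P p"
proof (induction p rule: update_induct)
  case const
  show ?case using assms(1)[of "[]" 0] by simp
next
  case (update f a b)
  have "Poly_Mapping.update a b f = f + Poly_Mapping.single a b"
    using update by (intro poly_mapping_eqI)
      (auto simp: lookup_update lookup_add lookup_single in_keys_iff when_def)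
  then show ?case using update assms by simp
qed

lemma free_const_commute: "free_const c * p = p * free_const c"
  by (induction p rule: free_alg_induct)
    (simp_all add: mult_single distrib_left distrib_right mult.commute)

lemma scale_mult_left [simp]: "(c *\<^sub>P x) * y = c *\<^sub>P (x * y)"
  by transfer (simp add: rel_cong_def rel_ideal.zero mult.assoc)

lemma scale_mult_right [simp]: "x * (c *\<^sub>P y) = c *\<^sub>P (x * y)"
  by transfer (simp add: rel_cong_def rel_ideal.zero free_const_commute mult.assoc)

lemma word_alg_append: "word_alg (u @ v) = word_alg u * word_alg v"
  by (simp add: word_alg_def)

lemma word_alg_Cons: "word_alg (a # v) = gen a * word_alg v"
  by (simp add: word_alg_def)

lemma word_alg_Nil [simp]: "word_alg [] = 1"
  by (simp add: word_alg_def)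

lemma word_alg_replicate: "word_alg (replicate k a) = gen a ^ k"
  by (induction k) (simp_all add: word_alg_Cons)

lemma word_alg_eq_abs: "word_alg w = abs_path_alg (free_word w)"
proof (induction w)
  case Nil
  have "free_word [] = 1" by (simp flip: zero_list_def)
  then show ?case by (simp add: one_path_alg.abs_eq)
next
  case (Cons a w)
  have "[a] + w = a # w" by (simp add: plus_list_def)
  then show ?case
    using Cons by (simp add: word_alg_Cons gen.abs_eq times_path_alg.abs_eq mult_single)
qed

lemma ene_relation: "(1 + q) *\<^sub>P (\<e> * \<n> * \<e>) = q *\<^sub>P (\<e> * \<e> * \<n>) + \<n> * \<e> * \<e>"
proof -
  have "relator_ene \<in> rel_ideal" using rel_ideal.ene[of 1 1] by simp
  then have "abs_path_alg (free_const (1 + q) * free_word [E, N, E])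
      = abs_path_alg (free_const q * free_word [E, E, N] + free_word [N, E, E])"
    by (simp add: path_alg.abs_eq_iff rel_cong_def relator_ene_def)
  then show ?thesis
    by (simp add: word_alg_Cons mult.assoc
        flip: scale_path_alg.abs_eq plus_path_alg.abs_eq word_alg_eq_abs)
qed

lemma nen_relation: "(1 + q) *\<^sub>P (\<n> * \<e> * \<n>) = q *\<^sub>P (\<e> * \<n> * \<n>) + \<n> * \<n> * \<e>"
proof -
  have "relator_nen \<in> rel_ideal" using rel_ideal.nen[of 1 1] by simp
  then have "abs_path_alg (free_const (1 + q) * free_word [N, E, N])
      = abs_path_alg (free_const q * free_word [E, N, N] + free_word [N, N, E])"
    by (simp add: path_alg.abs_eq_iff rel_cong_def relator_nen_def)
  then show ?thesis
    by (simp add: word_alg_Cons mult.assoc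
        flip: scale_path_alg.abs_eq plus_path_alg.abs_eq word_alg_eq_abs)
qed

text \<open>The q-integer comes from a polynomial with constant coefficient 1.\<close>

lemma qint_Suc_nonzero: "qint (Suc j) \<noteq> 0"
proof -
  have q_power: "q ^ i = Fract (monom 1 i) 1" for i
    by (induction i) (simp_all add: q_def One_fract_def monom_0 mult_monom monom_Suc pCons_one)
  have "qint j = Fract (\<Sum>i<j. monom 1 i) 1" for j
    by (induction j) (simp_all add: qint_def q_power Zero_fract_def)
  moreover have "coeff (\<Sum>i<Suc j. monom 1 i) 0 = (1 :: complex)"
    by (simp add: coeff_sum)
  then have "(\<Sum>i<Suc j. monom 1 i) \<noteq> (0 :: complex poly)" by (metis coeff_0 zero_neq_one)
  ultimately show ?thesis by (simp add: Zero_fract_def eq_fract del: sum.lessThan_Suc)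
qed

text \<open>
  The commutator \<open>\<c>\<close> turns the two relations into \<open>q\<close>-commutation rules, so that every
  word can be rewritten in terms of monomials \<open>\<e>\<^sup>a \<c>\<^sup>j \<n>\<^sup>b\<close>.
\<close>

definition \<c> :: path_alg where "\<c> = \<e> * \<n> - \<n> * \<e>"

lemma n_mult_e: "\<n> * \<e> = \<e> * \<n> - \<c>"
  by (simp add: \<c>_def)

text \<open>This is the relation ene rearranged as \<open>ene - nee = q (een - ene)\<close>;
  likewise \<open>n_mult_c\<close> is \<open>nen - nne = q (enn - nen)\<close>.\<close>

lemma c_mult_e: "\<c> * \<e> = q *\<^sub>P (\<e> * \<c>)"
proof -
  have "\<e> * \<n> * \<e> + q *\<^sub>P (\<e> * \<n> * \<e>) = q *\<^sub>P (\<e> * \<e> * \<n>) + \<n> * \<e> * \<e>"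
    using ene_relation by (simp only: path_alg.scale_left_distrib path_alg.scale_one)
  then have "\<e> * \<n> * \<e> - \<n> * \<e> * \<e> = q *\<^sub>P (\<e> * \<e> * \<n>) - q *\<^sub>P (\<e> * \<n> * \<e>)"
    by (simp only: diff_eq_eq add_diff_eq diff_add_eq eq_diff_eq)
  then show ?thesis
    by (simp only: \<c>_def left_diff_distrib right_diff_distrib path_alg.scale_right_diff_distrib mult.assoc)
qed

lemma n_mult_c: "\<n> * \<c> = q *\<^sub>P (\<c> * \<n>)"
proof -
  have "\<n> * \<e> * \<n> + q *\<^sub>P (\<n> * \<e> * \<n>) = q *\<^sub>P (\<e> * \<n> * \<n>) + \<n> * \<n> * \<e>"
    using nen_relation by (simp only: path_alg.scale_left_distrib path_alg.scale_one)
  then have "\<n> * \<e> * \<n> - \<n> * \<n> * \<e> = q *\<^sub>P (\<e> * \<n> * \<n>) - q *\<^sub>P (\<n> * \<e> * \<n>)"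
    by (simp only: diff_eq_eq add_diff_eq diff_add_eq eq_diff_eq)
  then show ?thesis
    by (simp only: \<c>_def left_diff_distrib right_diff_distrib path_alg.scale_right_diff_distrib mult.assoc)
qed

lemma c_mult_e_power: "\<c> * \<e> ^ a = q ^ a *\<^sub>P (\<e> ^ a * \<c>)"
proof (induction a)
  case (Suc a)
  have "\<c> * \<e> ^ Suc a = q *\<^sub>P (\<e> * (\<c> * \<e> ^ a))"
    by (simp add: c_mult_e mult.assoc[symmetric])
  then show ?case by (simp add: Suc mult.assoc)
qed simp

lemma c_power_mult_e: "\<c> ^ j * \<e> = q ^ j *\<^sub>P (\<e> * \<c> ^ j)"
proof (induction j)
  case (Suc j)
  have "\<c> ^ Suc j * \<e> = \<c> * (\<c> ^ j * \<e>)" by (simp add: mult.assoc)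
  also have "\<dots> = q ^ j *\<^sub>P ((\<c> * \<e>) * \<c> ^ j)" by (simp add: Suc mult.assoc)
  finally show ?case by (simp add: c_mult_e mult.assoc mult.commute)
qed simp

lemma n_mult_c_power: "\<n> * \<c> ^ j = q ^ j *\<^sub>P (\<c> ^ j * \<n>)"
proof (induction j)
  case (Suc j)
  have "\<n> * \<c> ^ Suc j = q *\<^sub>P (\<c> * (\<n> * \<c> ^ j))"
    by (simp add: n_mult_c mult.assoc[symmetric])
  then show ?case by (simp add: Suc mult.assoc)
qed simp

text \<open>For spanning only the shape matters; the scalar is
  \<open>r = - qint (Suc a)\<close>.\<close>

lemma n_mult_e_power: "\<exists>r. \<n> * \<e> ^ Suc a = \<e> ^ Suc a * \<n> + r *\<^sub>P (\<e> ^ a * \<c>)"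
proof (induction a)
  case 0
  show ?case by (intro exI[of _ "-1"]) (simp add: n_mult_e)
next
  case (Suc a)
  then obtain r where r: "\<n> * \<e> ^ Suc a = \<e> ^ Suc a * \<n> + r *\<^sub>P (\<e> ^ a * \<c>)" by blast
  have "\<n> * \<e> ^ Suc (Suc a) = (\<n> * \<e>) * \<e> ^ Suc a"
    by (simp only: power_Suc mult.assoc)
  also have "\<dots> = \<e> * (\<n> * \<e> ^ Suc a) - \<c> * \<e> ^ Suc a"
    by (simp only: n_mult_e left_diff_distrib mult.assoc)
  also have "\<dots> = \<e> ^ Suc (Suc a) * \<n> + (r - q ^ Suc a) *\<^sub>P (\<e> ^ Suc a * \<c>)"
    unfolding r c_mult_e_power
    by (simp add: distrib_left mult.assoc path_alg.scale_left_diff_distrib)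
  finally show ?case by blast
qed

text \<open>Here the exact coefficient is recorded, because it is later divided by.\<close>

lemma n_power_mult_e: "\<n> ^ Suc m * \<e> = \<e> * \<n> ^ Suc m - qint (Suc m) *\<^sub>P (\<c> * \<n> ^ m)"
proof (induction m)
  case 0
  then show ?case by (simp add: n_mult_e qint_def)
next
  case (Suc m)
  have "\<n> ^ Suc (Suc m) * \<e> = \<n> * (\<n> ^ Suc m * \<e>)" by (simp add: mult.assoc)
  also have "\<dots> = (\<n> * \<e>) * \<n> ^ Suc m - qint (Suc m) *\<^sub>P ((\<n> * \<c>) * \<n> ^ m)"
    unfolding Suc by (simp add: right_diff_distrib mult.assoc)
  also have "\<dots> = \<e> * \<n> ^ Suc (Suc m) - (1 + q * qint (Suc m)) *\<^sub>P (\<c> * \<n> ^ Suc m)"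
    by (simp add: n_mult_e n_mult_c left_diff_distrib mult.assoc path_alg.scale_left_distrib mult.commute)
  also have "1 + q * qint (Suc m) = qint (Suc (Suc m))"
    unfolding qint_def by (subst (2) sum.lessThan_Suc_shift) (simp add: sum_distrib_left algebra_simps)
  finally show ?case .
qed

section \<open>From ordered monomials to rectangle words\<close>

text \<open>The commutator has bidegree \<open>(1, 1)\<close>, so \<open>j\<close> counts towards
  both letters.\<close>

definition pbw_span :: "nat \<Rightarrow> nat \<Rightarrow> path_alg set" where
  "pbw_span m n = path_alg_span {\<e> ^ a * \<c> ^ j * \<n> ^ b | a j b. a + j = n \<and> b + j = m}"

text \<open>The generators are the words of the partitions with \<open>m\<close> rows of equal
  length \<open>k\<close>.\<close>

definition rect_span :: "nat \<Rightarrow> nat \<Rightarrow> path_alg set" where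
  "rect_span m n = path_alg_span {\<e> ^ k * \<n> ^ m * \<e> ^ (n - k) | k. k \<le> n}"

lemma path_alg_span_mult_left:
  assumes "x \<in> path_alg_span S" "\<And>y. y \<in> S \<Longrightarrow> z * y \<in> path_alg_span T"
  shows "z * x \<in> path_alg_span T"
  using assms(1)
  by (induction rule: path_alg.span_induct_alt)
    (simp_all add: distrib_left path_alg.span_zero path_alg.span_add path_alg.span_scale assms(2))

lemma path_alg_span_mult_right:
  assumes "x \<in> path_alg_span S" "\<And>y. y \<in> S \<Longrightarrow> y * z \<in> path_alg_span T"
  shows "x * z \<in> path_alg_span T"
  using assms(1)
  by (induction rule: path_alg.span_induct_alt)
    (simp_all add: distrib_right path_alg.span_zero path_alg.span_add path_alg.span_scale assms(2))

text \<open>Letters are prepended one at a time: e fits directly, and n is moved to the right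
  through the powers of e and of the commutator.\<close>

lemma word_alg_in_pbw_span: "word_alg w \<in> pbw_span (count_list w N) (count_list w E)"
proof (induction w)
  case Nil
  show ?case unfolding pbw_span_def
    by (rule path_alg.span_base) (auto intro!: exI[of _ 0])
next
  case (Cons l w)
  let ?m = "count_list w N" and ?n = "count_list w E"
  show ?case
  proof (cases l)
    case E
    have "\<e> * word_alg w \<in> pbw_span ?m (Suc ?n)"
      using Cons unfolding pbw_span_def
    proof (rule path_alg_span_mult_left)
      fix y assume "y \<in> {\<e> ^ a * \<c> ^ j * \<n> ^ b | a j b. a + j = ?n \<and> b + j = ?m}"
      then obtain a j b where y: "y = \<e> ^ a * \<c> ^ j * \<n> ^ b" and "a + j = ?n" "b + j = ?m"
        by blast
      moreover have "\<e> * y = \<e> ^ Suc a * \<c> ^ j * \<n> ^ b" unfolding y by (simp add: mult.assoc)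
      moreover have "Suc a + j = Suc ?n" using \<open>a + j = ?n\<close> by simp
      ultimately show "\<e> * y \<in> path_alg_span {\<e> ^ a * \<c> ^ j * \<n> ^ b | a j b. a + j = Suc ?n \<and> b + j = ?m}"
        by (intro path_alg.span_base) blast
    qed
    then show ?thesis using E by (simp add: word_alg_Cons)
  next
    case N
    have "\<n> * word_alg w \<in> pbw_span (Suc ?m) ?n"
      using Cons unfolding pbw_span_def
    proof (rule path_alg_span_mult_left)
      let ?T = "{\<e> ^ a * \<c> ^ j * \<n> ^ b | a j b. a + j = ?n \<and> b + j = Suc ?m}"
      fix y assume "y \<in> {\<e> ^ a * \<c> ^ j * \<n> ^ b | a j b. a + j = ?n \<and> b + j = ?m}"
      then obtain a j b where y: "y = \<e> ^ a * \<c> ^ j * \<n> ^ b" and ab: "a + j = ?n" "b + j = ?m"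
        by blast
      have 1: "\<e> ^ a * \<c> ^ j * \<n> ^ Suc b \<in> path_alg_span ?T"
        using ab by (intro path_alg.span_base) fastforce
      show "\<n> * y \<in> path_alg_span ?T"
      proof (cases a)
        case 0
        then have "\<n> * y = q ^ j *\<^sub>P (\<e> ^ a * \<c> ^ j * \<n> ^ Suc b)"
          unfolding y by (simp add: n_mult_c_power mult.assoc[symmetric])
        then show ?thesis using 1 by (simp add: path_alg.span_scale)
      next
        case (Suc a')
        obtain r where r: "\<n> * \<e> ^ a = \<e> ^ a * \<n> + r *\<^sub>P (\<e> ^ a' * \<c>)"
          using n_mult_e_power Suc by blast
        have 2: "\<e> ^ a' * \<c> ^ Suc j * \<n> ^ b \<in> path_alg_span ?T"
          using ab Suc by (intro path_alg.span_base) fastforce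
        have "\<n> * y = (\<n> * \<e> ^ a) * (\<c> ^ j * \<n> ^ b)" unfolding y by (simp add: mult.assoc)
        also have "\<dots> = \<e> ^ a * (\<n> * \<c> ^ j) * \<n> ^ b + r *\<^sub>P (\<e> ^ a' * \<c> ^ Suc j * \<n> ^ b)"
          unfolding r by (simp add: distrib_right mult.assoc)
        also have "\<dots> = q ^ j *\<^sub>P (\<e> ^ a * \<c> ^ j * \<n> ^ Suc b) + r *\<^sub>P (\<e> ^ a' * \<c> ^ Suc j * \<n> ^ b)"
          unfolding n_mult_c_power by (simp add: mult.assoc)
        finally show ?thesis using 1 2 by (simp add: path_alg.span_scale path_alg.span_add)
      qed
    qed
    then show ?thesis using N by (simp add: word_alg_Cons)
  qed
qed

lemma rect_span_e_mult: "x \<in> rect_span m n \<Longrightarrow> \<e> * x \<in> rect_span m (Suc n)"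
  unfolding rect_span_def
proof (erule path_alg_span_mult_left)
  fix y assume "y \<in> {\<e> ^ k * \<n> ^ m * \<e> ^ (n - k) | k. k \<le> n}"
  then obtain k where "k \<le> n" "y = \<e> ^ k * \<n> ^ m * \<e> ^ (n - k)" by blast
  then have "\<e> * y = \<e> ^ Suc k * \<n> ^ m * \<e> ^ (Suc n - Suc k)" "Suc k \<le> Suc n"
    by (simp_all add: mult.assoc)
  then show "\<e> * y \<in> path_alg_span {\<e> ^ k * \<n> ^ m * \<e> ^ (Suc n - k) | k. k \<le> Suc n}"
    by (intro path_alg.span_base) blast
qed

lemma rect_span_mult_e: "x \<in> rect_span m n \<Longrightarrow> x * \<e> \<in> rect_span m (Suc n)"
  unfolding rect_span_def
proof (erule path_alg_span_mult_right)
  fix y assume "y \<in> {\<e> ^ k * \<n> ^ m * \<e> ^ (n - k) | k. k \<le> n}"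
  then obtain k where "k \<le> n" "y = \<e> ^ k * \<n> ^ m * \<e> ^ (n - k)" by blast
  then have "y * \<e> = \<e> ^ k * \<n> ^ m * \<e> ^ (Suc n - k)" "k \<le> Suc n"
    by (simp_all add: mult.assoc Suc_diff_le power_Suc2 del: power_Suc)
  then show "y * \<e> \<in> path_alg_span {\<e> ^ k * \<n> ^ m * \<e> ^ (Suc n - k) | k. k \<le> Suc n}"
    by (intro path_alg.span_base) blast
qed

text \<open>Induction on \<open>n\<close> with \<open>m\<close> fixed. Monomials containing an e
  arise by left multiplication with e; only the one with \<open>j = Suc n\<close> is new.\<close>

lemma pbw_monomial_in_rect_span:
  assumes "j \<le> n" "n \<le> m"
  shows "\<e> ^ (n - j) * \<c> ^ j * \<n> ^ (m - j) \<in> rect_span m n"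
  using assms
proof (induction n arbitrary: j)
  case 0
  then show ?case unfolding rect_span_def by (intro path_alg.span_base) auto
next
  case (Suc n)
  show ?case
  proof (cases "j \<le> n")
    case True
    then have "\<e> * (\<e> ^ (n - j) * \<c> ^ j * \<n> ^ (m - j)) \<in> rect_span m (Suc n)"
      using Suc by (intro rect_span_e_mult) auto
    then show ?thesis using True by (simp add: Suc_diff_le mult.assoc)
  next
    case False
    then have j: "j = Suc n" using Suc.prems by simp
    obtain d where d: "m - n = Suc d" "m - Suc n = d"
      using Suc.prems by (metis Suc_diff_Suc Suc_le_lessD)
    define y where "y = \<c> ^ n * \<n> ^ (m - n)"
    have y: "y \<in> rect_span m n" using Suc.IH[of n] Suc.prems by (simp add: y_def)
    \<comment> \<open>Right multiplication of \<open>y\<close> by e gives a multiple of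
      \<open>\<e> * y\<close> minus \<open>qint (m - n)\<close> times the new monomial. Since
      \<open>n < m\<close>, this q-integer is nonzero and the new monomial can be solved
      for.\<close>
    have "y * \<e> = (\<c> ^ n * \<e>) * \<n> ^ (m - n) - qint (m - n) *\<^sub>P (\<c> ^ Suc n * \<n> ^ d)"
      unfolding y_def d mult.assoc n_power_mult_e power_Suc2[of _ n]
      by (simp only: right_diff_distrib scale_mult_right mult.assoc)
    also have "(\<c> ^ n * \<e>) * \<n> ^ (m - n) = q ^ n *\<^sub>P (\<e> * y)"
      unfolding c_power_mult_e y_def by (simp add: mult.assoc)
    finally have "qint (m - n) *\<^sub>P (\<c> ^ Suc n * \<n> ^ d) = q ^ n *\<^sub>P (\<e> * y) - y * \<e>"
      by simp
    then have "qint (m - n) *\<^sub>P (\<c> ^ Suc n * \<n> ^ d) \<in> rect_span m (Suc n)"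
      using rect_span_e_mult[OF y] rect_span_mult_e[OF y]
      by (simp add: rect_span_def path_alg.span_diff path_alg.span_scale)
    then have "inverse (qint (m - n)) *\<^sub>P qint (m - n) *\<^sub>P (\<c> ^ Suc n * \<n> ^ d) \<in> rect_span m (Suc n)"
      unfolding rect_span_def by (rule path_alg.span_scale)
    then show ?thesis using j d qint_Suc_nonzero[of d] by simp
  qed
qed

lemma word_alg_in_rect_span:
  assumes "count_list w E \<le> count_list w N"
  shows "word_alg w \<in> rect_span (count_list w N) (count_list w E)"
proof -
  let ?m = "count_list w N" and ?n = "count_list w E"
  have "pbw_span ?m ?n \<subseteq> rect_span ?m ?n"
    unfolding pbw_span_def rect_span_def
  proof (rule path_alg.span_minimal[OF _ path_alg.subspace_span], safe)
    fix a j b assume ab: "a + j = ?n" "b + j = ?m"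
    then have "?n - j = a" "?m - j = b" "j \<le> ?n" by auto
    then show "\<e> ^ a * \<c> ^ j * \<n> ^ b \<in> path_alg_span {\<e> ^ k * \<n> ^ ?m * \<e> ^ (?n - k) | k. k \<le> ?n}"
      using pbw_monomial_in_rect_span[of j ?n ?m] assms by (simp add: rect_span_def)
  qed
  then show ?thesis using word_alg_in_pbw_span by blast
qed

section \<open>The expansion map\<close>

text \<open>Defined on words rather than partitions, so that the relators can be checked in context;
  its coefficients are the hit numbers.\<close>

definition hit_poly :: "letter list \<Rightarrow> ratfun poly" where
  "hit_poly w = transfer [:q:] [:0, 1:] w 0 {1..count_list w E}"

text \<open>The claimed expansion with the denominator cleared.\<close>

definition rect_expansion :: "letter list \<Rightarrow> path_alg" where
  "rect_expansion w = (\<Sum>k\<le>count_list w E. coeff (hit_poly w) k *\<^sub>P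
     (\<e> ^ k * \<n> ^ count_list w N * \<e> ^ (count_list w E - k)))"

text \<open>Equal letter counts mean that the same rectangle words occur in all three expansions, so
  comparing coefficients suffices.\<close>

lemma rect_expansion_relation:
  assumes "\<And>l. count_list w1 l = count_list w l" "\<And>l. count_list w2 l = count_list w l"
    and "(1 + [:q:]) * hit_poly w = [:q:] * hit_poly w1 + hit_poly w2"
  shows "(1 + q) *\<^sub>P rect_expansion w = q *\<^sub>P rect_expansion w1 + rect_expansion w2"
proof -
  have "coeff ((1 + [:q:]) * hit_poly w) k = (1 + q) * coeff (hit_poly w) k" for k
    by (simp add: one_pCons)
  then have "(1 + q) * coeff (hit_poly w) k = q * coeff (hit_poly w1) k + coeff (hit_poly w2) k" for k
    unfolding assms(3) by simp
  then show ?thesis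
    unfolding rect_expansion_def assms(1,2) path_alg.scale_sum_right
    by (simp flip: sum.distrib path_alg.scale_left_distrib)
qed

lemma rect_expansion_ene:
  "(1 + q) *\<^sub>P rect_expansion (u @ [E, N, E] @ v)
     = q *\<^sub>P rect_expansion (u @ [E, E, N] @ v) + rect_expansion (u @ [N, E, E] @ v)"
  using transfer_ene[OF refl, of "[:q:]" "[:0, 1:]" u v]
  by (intro rect_expansion_relation) (simp_all add: hit_poly_def)

lemma rect_expansion_nen:
  "(1 + q) *\<^sub>P rect_expansion (u @ [N, E, N] @ v)
     = q *\<^sub>P rect_expansion (u @ [E, N, N] @ v) + rect_expansion (u @ [N, N, E] @ v)"
  using transfer_nen[of _ "[:q:]" "[:0, 1:]" u v 0]
  by (intro rect_expansion_relation) (simp_all add: hit_poly_def)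

section \<open>Linear extension and descent to the quotient\<close>

definition extend_linear :: "(letter list \<Rightarrow> path_alg) \<Rightarrow> free_alg \<Rightarrow> path_alg" where
  "extend_linear f p = (\<Sum>w\<in>Poly_Mapping.keys p. Poly_Mapping.lookup p w *\<^sub>P f w)"

lemma extend_linear_add: "extend_linear f (p + r) = extend_linear f p + extend_linear f r"
  unfolding extend_linear_def
  by (rule setsum_keys_plus_distrib) (simp_all add: path_alg.scale_left_distrib)

lemma extend_linear_single [simp]: "extend_linear f (Poly_Mapping.single w c) = c *\<^sub>P f w"
  by (simp add: extend_linear_def)

lemma extend_linear_diff: "extend_linear f (p - r) = extend_linear f p - extend_linear f r"
  using extend_linear_add[of f "p - r" r] by (simp add: algebra_simps)

lemma extend_linear_const: "extend_linear f (free_const c * p) = c *\<^sub>P extend_linear f p"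
  by (induction p rule: free_alg_induct)
    (simp_all add: distrib_left extend_linear_add mult_single path_alg.scale_right_distrib)

text \<open>Scalars are central, so by linearity in \<open>a\<close> and \<open>b\<close> it
  suffices to test words.\<close>

lemma extend_linear_sandwich:
  assumes "\<And>u v. extend_linear f (free_word u * r * free_word v) = 0"
  shows "extend_linear f (a * r * b) = 0"
proof (induction a rule: free_alg_induct)
  case (single u c)
  show ?case
  proof (induction b rule: free_alg_induct)
    case (single v d)
    have "Poly_Mapping.single u c * r * Poly_Mapping.single v d
        = free_const c * (free_const d * (free_word u * r * free_word v))"
    proof -
      have "Poly_Mapping.single u c = free_const c * free_word u"
        "Poly_Mapping.single v d = free_const d * free_word v" by (simp_all add: mult_single)
      then show ?thesis by (metis (no_types, lifting) free_const_commute mult.assoc)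
    qed
    then show ?case using assms by (simp add: extend_linear_const)
  next
    case (add p s)
    then show ?case by (simp add: distrib_left extend_linear_add)
  qed
next
  case (add p s)
  then show ?case by (simp add: distrib_right extend_linear_add)
qed

text \<open>A relator placed between two words maps to zero by the identities for
  \<open>rect_expansion\<close>; hence the map descends to the quotient.\<close>

lemma extend_linear_rel_ideal:
  assumes "p \<in> rel_ideal"
  shows "extend_linear rect_expansion p = 0"
  using assms
proof (induction rule: rel_ideal.induct)
  case zero
  then show ?case by (simp add: extend_linear_def)
next
  case (ene a b)
  show ?case
  proof (rule extend_linear_sandwich)
    fix u v
    have "free_word u * relator_ene * free_word v
      = Poly_Mapping.single (u @ [E, N, E] @ v) (1 + q)
        - (Poly_Mapping.single (u @ [E, E, N] @ v) q + Poly_Mapping.single (u @ [N, E, E] @ v) 1)"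
      by (simp add: relator_ene_def mult_single algebra_simps plus_list_def zero_list_def)
    then show "extend_linear rect_expansion (free_word u * relator_ene * free_word v) = 0"
      using rect_expansion_ene[of u v] by (simp add: extend_linear_diff extend_linear_add)
  qed
next
  case (nen a b)
  show ?case
  proof (rule extend_linear_sandwich)
    fix u v
    have "free_word u * relator_nen * free_word v
      = Poly_Mapping.single (u @ [N, E, N] @ v) (1 + q)
        - (Poly_Mapping.single (u @ [E, N, N] @ v) q + Poly_Mapping.single (u @ [N, N, E] @ v) 1)"
      by (simp add: relator_nen_def mult_single algebra_simps plus_list_def zero_list_def)
    then show "extend_linear rect_expansion (free_word u * relator_nen * free_word v) = 0"
      using rect_expansion_nen[of u v] by (simp add: extend_linear_diff extend_linear_add)
  qed
next
  case (add x y)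
  then show ?case by (simp add: extend_linear_add)
qed

text \<open>Defined through a chosen representative; \<open>expansion_map_abs\<close> shows
  independence of the choice, as two representatives differ by an element of the ideal.\<close>

definition expansion_map :: "path_alg \<Rightarrow> path_alg" where
  "expansion_map x = extend_linear rect_expansion (rep_path_alg x)"

lemma expansion_map_abs: "expansion_map (abs_path_alg p) = extend_linear rect_expansion p"
proof -
  have "abs_path_alg (rep_path_alg (abs_path_alg p)) = abs_path_alg p"
    by (rule Quotient3_abs_rep[OF Quotient3_path_alg])
  then have "rep_path_alg (abs_path_alg p) - p \<in> rel_ideal"
    by (simp add: path_alg.abs_eq_iff rel_cong_def)
  then show ?thesis
    using extend_linear_rel_ideal by (fastforce simp: expansion_map_def extend_linear_diff)
qed

lemma expansion_map_add: "expansion_map (x + y) = expansion_map x + expansion_map y"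
  by (induction x rule: path_alg.abs_induct, induction y rule: path_alg.abs_induct)
    (simp add: plus_path_alg.abs_eq expansion_map_abs extend_linear_add)

lemma expansion_map_scale: "expansion_map (c *\<^sub>P x) = c *\<^sub>P expansion_map x"
  by (induction x rule: path_alg.abs_induct)
    (simp add: scale_path_alg.abs_eq expansion_map_abs extend_linear_const)

lemma expansion_map_word: "expansion_map (word_alg w) = rect_expansion w"
  by (simp add: word_alg_eq_abs expansion_map_abs)

section \<open>Rectangle words as eigenvectors\<close>

lemma count_list_replicate: "count_list (replicate k a) b = (if a = b then k else 0)"
  by (induction k) auto

text \<open>After the leading \<open>E\<close>s the start is \<open>k\<close>, and the columns
  \<open>1..k\<close> are the hit columns in \<open>transfer_rectangle\<close>.\<close>

lemma hit_poly_rectangle: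
  assumes "k \<le> n"
  shows "hit_poly (replicate k E @ replicate m N @ replicate (n - k) E)
    = monom (\<Prod>j<n. qint (m - j)) k"
proof -
  have qnum: "qnum [:q:] j = [:qint j:]" for j
    by (induction j) (simp_all add: qnum_def qint_def poly_const_pow)
  have prod: "(\<Prod>j<i. [:qint (m - j):]) = [:\<Prod>j<i. qint (m - j):]" for i
    by (induction i) (simp_all add: one_pCons mult.commute)
  have "{c \<in> {1..n}. c \<le> k} = {1..k}" using assms by auto
  then have "hit_poly (replicate k E @ replicate m N @ replicate (n - k) E)
      = [:\<Prod>j<n. qint (m - j):] * [:0, 1:] ^ k"
    using assms transfer_rectangle[of "{1..n}" "[:q:]" "[:0, 1:]" m "n - k" k]
    by (simp add: hit_poly_def count_list_replicate transfer_append_E qnum prod)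
  then show ?thesis by (simp add: monom_altdef)
qed

text \<open>As \<open>hit_poly\<close> is a monomial of degree \<open>k\<close>, only the word
  itself survives in its expansion. The eigenvalue does not depend on \<open>k\<close>, so it is the
  same on all of \<open>rect_span m n\<close>.\<close>

lemma expansion_map_rectangle:
  assumes "k \<le> n"
  shows "expansion_map (\<e> ^ k * \<n> ^ m * \<e> ^ (n - k))
    = (\<Prod>j<n. qint (m - j)) *\<^sub>P (\<e> ^ k * \<n> ^ m * \<e> ^ (n - k))"
proof -
  let ?w = "replicate k E @ replicate m N @ replicate (n - k) E"
  let ?r = "\<lambda>i. \<e> ^ i * \<n> ^ m * \<e> ^ (n - i)"
  have "expansion_map (?r k) = rect_expansion ?w"
    using expansion_map_word[of ?w] by (simp add: word_alg_append word_alg_replicate mult.assoc)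
  also have "\<dots> = (\<Sum>i\<le>n. (if k = i then \<Prod>j<n. qint (m - j) else 0) *\<^sub>P ?r i)"
    using assms by (simp add: rect_expansion_def hit_poly_rectangle count_list_replicate)
  also have "\<dots> = (\<Sum>i\<le>n. if k = i then (\<Prod>j<n. qint (m - j)) *\<^sub>P ?r i else 0)"
    by (rule sum.cong) auto
  also have "\<dots> = (\<Prod>j<n. qint (m - j)) *\<^sub>P ?r k"
    using assms by simp
  finally show ?thesis .
qed

lemma expansion_map_rect_span:
  assumes "x \<in> rect_span m n"
  shows "expansion_map x = (\<Prod>j<n. qint (m - j)) *\<^sub>P x"
  using assms unfolding rect_span_def
proof (induction rule: path_alg.span_induct_alt)
  case base
  show ?case using expansion_map_scale[of 0 0] by simp
next
  case (step c x y)
  then obtain k where "k \<le> n" "x = \<e> ^ k * \<n> ^ m * \<e> ^ (n - k)" by blast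
  then show ?case
    using step by (simp add: expansion_map_add expansion_map_scale expansion_map_rectangle
        path_alg.scale_right_distrib mult.commute)
qed

theorem theorem3p3:
  fixes m n :: nat and lam :: "nat \<Rightarrow> nat"
  assumes "n \<le> m" and "partition_in_box m n lam"
  shows "word_alg (word_of m n lam) \<in> path_alg_component m n \<and>
    word_alg (word_of m n lam) =
      (\<Sum>k=0..n. (hit_number m n lam k / (\<Prod>j<n. qint (m - j))) *\<^sub>P (\<e> ^ k * \<n> ^ m * \<e> ^ (n - k)))"
proof
  let ?w = "word_of m n lam" and ?Z = "\<Prod>j<n. qint (m - j)"
  let ?r = "\<lambda>k. \<e> ^ k * \<n> ^ m * \<e> ^ (n - k)"
  have w: "is_word_of m n lam ?w"
    unfolding word_of_def using theI'[OF ex1_word_of[OF assms(2)]] .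
  then have count: "count_list ?w N = m" "count_list ?w E = n" by (auto simp: is_word_of_def)
  then show "word_alg ?w \<in> path_alg_component m n"
    unfolding path_alg_component_def by (intro path_alg.span_base) blast
  \<comment> \<open>From \<open>j < n\<close> and \<open>n \<le> m\<close> follows
    \<open>m - j \<ge> 1\<close>.\<close>
  have "qint (m - j) \<noteq> 0" if "j < n" for j
    using qint_Suc_nonzero[of "m - Suc j"] that assms(1) by (simp add: Suc_diff_Suc)
  then have Z: "?Z \<noteq> 0" by simp
  have "hit_poly ?w = rook_sum [:q:] [:0, 1:] m lam {1..n}"
    using transfer_eq_rook_sum[OF w, of "{1..n}" _ _ 0] count by (simp add: hit_poly_def)
  \<comment> \<open>Both sides are values of \<open>expansion_map\<close> at the word: the left by
    the eigenvalue on \<open>rect_span m n\<close>, the right by its definition on words.\<close>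
  then have "?Z *\<^sub>P word_alg ?w = (\<Sum>k\<le>n. hit_number m n lam k *\<^sub>P ?r k)"
    using word_alg_in_rect_span[of ?w] expansion_map_rect_span[of "word_alg ?w" m n]
      expansion_map_word[of ?w] assms(1) count
    by (simp add: rect_expansion_def coeff_rook_sum del: One_nat_def)
  then have "inverse ?Z *\<^sub>P ?Z *\<^sub>P word_alg ?w
      = (\<Sum>k\<le>n. (hit_number m n lam k / ?Z) *\<^sub>P ?r k)"
    by (simp only: path_alg.scale_sum_right path_alg.scale_scale divide_inverse mult.commute)
  then show "word_alg ?w = (\<Sum>k=0..n. (hit_number m n lam k / ?Z) *\<^sub>P ?r k)"
    using Z by (simp add: atLeast0AtMost del: prod_zero_iff)
qed

end
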